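(* Let $M$ be an $n$-dimensional Riemannian manifold and let $x:M\to H^{n+1}$ (resp. $x:M\to S_1^{n+1}$) be an immersed hypersurface (resp. space-like immersed hypersurface) without umbilics. Then the normal Gauss map of $x(M)$ is conformal if and only if at each point of $M$ there exist exactly two distinct principal curvatures and the sectional curvature of $M$ satisfies $$R(X\wedge Y)=-1+\eta_{n+1}^2\qquad(\text{resp. } R(X\wedge Y)=1-\eta_{n+1}^2)$$ whenever the (nonzero) vectors $X$ and $Y$ belong to different principal direction spaces.
   Context: Ambient spaces. Let $R_+^{n+1}=\{(x_1,\dots,x_{n+1})\in\mathbb R^{n+1}: x_{n+1}>0\}$. $H^{n+1}$ is $R_+^{n+1}$ with the Riemannian metric $\frac{1}{x_{n+1}^2}(dx_1^2+\cdots+dx_{n+1}^2)$ (hyperbolic space). $S_1^{n+1}$ (upper half-space model of de Sitter space) is $R_+^{n+1}$ with the Lorentz metric $\frac{1}{x_{n+1}^2}(dx_1^2+\cdots+dx_n^2-dx_{n+1}^2)$. Hypersurfaces. $M$ carries the induced Riemannian metric $\mathrm I$. The unit normal (resp. time-like unit normal) is $N=\sum_{A=1}^{n+1}x_{n+1}\eta_A\frac{\partial}{\partial x_A}$, with $\eta_1^2+\cdots+\eta_{n+1}^2=1$ (resp. $\eta_1^2+\cdots+\eta_n^2-\eta_{n+1}^2=-1$). The second fundamental form $\mathrm{II}$ is defined, with $D$ the ambient and $\nabla$ the induced Levi-Civita connection, by $D_XY=\nabla_XY+\mathrm{II}(X,Y)N$. Principal curvatures and principal direction spaces are the eigenvalues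 and eigenspaces of $\mathrm{II}$ with respect to $\mathrm I$. An umbilic is a point at which $\mathrm{II}$ is a multiple of $\mathrm I$. Normal Gauss map. It is the map $\widetilde N=(\eta_1,\dots,\eta_{n+1})$, with values in $S^n(1)\subset\mathbb R^{n+1}$ (resp. in $H^n(-1)\subset L^{n+1}$, where $L^{n+1}$ is $\mathbb R^{n+1}$ with the Lorentz-Minkowski product $dx_1^2+\cdots+dx_n^2-dx_{n+1}^2$). The fourth fundamental form is $\mathrm{IV}=\langle d\widetilde N,d\widetilde N\rangle$, with $\langle\cdot,\cdot\rangle$ the Euclidean metric of $\mathbb R^{n+1}$ (resp. the Lorentz-Minkowski metric of $L^{n+1}$). The normal Gauss map is called conformal if $\mathrm{IV}=\rho\,\mathrm{II}$ for some smooth function $\rho$ on $M$. *)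

theory Defs
  imports "HOL-Analysis.Analysis"
begin

section \<open>Smooth maps and smooth manifolds\<close>

text \<open>\<open>Ck_on k S f\<close>: \<open>f\<close> is of class \<open>C\<^sup>k\<close> on the open set \<open>S\<close>.\<close>

primrec Ck_on ::
  "nat \<Rightarrow> 'a::real_normed_vector set \<Rightarrow> ('a \<Rightarrow> 'b::real_normed_vector) \<Rightarrow> bool" where
  "Ck_on 0 S f \<longleftrightarrow> continuous_on S f"
| "Ck_on (Suc k) S f \<longleftrightarrow>
     (\<forall>x\<in>S. f differentiable (at x)) \<and> (\<forall>v. Ck_on k S (\<lambda>x. frechet_derivative f (at x) v))"

definition smooth_on ::
  "'a::real_normed_vector set \<Rightarrow> ('a \<Rightarrow> 'b::real_normed_vector) \<Rightarrow> bool" where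
  "smooth_on S f \<longleftrightarrow> (\<forall>k. Ck_on k S f)"

text \<open>A chart is a pair of its domain and its coordinate map. The manifold \<open>M\<close> is the whole
  type \<open>'m\<close>; its dimension \<open>n\<close> is the cardinality of the index type \<open>'n\<close>. An atlas need not be
  maximal.\<close>

type_synonym ('m, 'n) chart = "'m set \<times> ('m \<Rightarrow> real^'n)"

definition chart_range :: "('m, 'n) chart \<Rightarrow> (real^'n) set" where
  "chart_range c = snd c ` fst c"

definition chart_inv :: "('m, 'n) chart \<Rightarrow> real^'n \<Rightarrow> 'm" where
  "chart_inv c = inv_into (fst c) (snd c)"

definition smooth_atlas :: "('m::topological_space, 'n::finite) chart set \<Rightarrow> bool" where
  "smooth_atlas A \<longleftrightarrow>
     (\<Union>c\<in>A. fst c) = UNIV \<and>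
     (\<forall>c\<in>A. open (fst c) \<and> open (chart_range c) \<and>
        homeomorphism (fst c) (chart_range c) (snd c) (chart_inv c)) \<and>
     (\<forall>c\<in>A. \<forall>d\<in>A. smooth_on (snd c ` (fst c \<inter> fst d)) (snd d \<circ> chart_inv c))"

definition smooth_map ::
  "('m, 'n::finite) chart set \<Rightarrow> ('m \<Rightarrow> 'b::real_normed_vector) \<Rightarrow> bool" where
  "smooth_map A f \<longleftrightarrow> (\<forall>c\<in>A. smooth_on (chart_range c) (f \<circ> chart_inv c))"

section \<open>Levi-Civita connection and curvature in coordinates\<close>

text \<open>A metric \<open>G\<close> on an open subset of a Euclidean space assigns a bilinear form \<open>G p\<close> to each
  point \<open>p\<close>. Its Levi-Civita connection is \<open>D\<^sub>X Y = dY(X) + B\<^sub>p(X, Y)\<close>, where the Christoffel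
  form \<open>B\<^sub>p\<close> is the unique one making the connection torsion-free (\<open>B\<^sub>p\<close> symmetric) and metric.
  The metric need not be definite, only nondegenerate.\<close>

definition christoffel ::
  "('a::euclidean_space \<Rightarrow> 'a \<Rightarrow> 'a \<Rightarrow> real) \<Rightarrow> 'a \<Rightarrow> 'a \<Rightarrow> 'a \<Rightarrow> 'a" where
  "christoffel G p = (THE B. bilinear B \<and> (\<forall>u v. B u v = B v u) \<and>
     (\<forall>u v w. frechet_derivative (\<lambda>q. G q v w) (at p) u = G p (B u v) w + G p v (B u w)))"

text \<open>Covariant derivative at \<open>q\<close>, in the direction \<open>u\<close>, of a vector field \<open>Y\<close> along a map \<open>f\<close>
  into the space carrying \<open>G\<close>; for \<open>f = id\<close> this is the connection of \<open>G\<close> itself.\<close>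

definition cov_deriv ::
  "('a::euclidean_space \<Rightarrow> 'a \<Rightarrow> 'a \<Rightarrow> real) \<Rightarrow> ('c::real_normed_vector \<Rightarrow> 'a) \<Rightarrow> ('c \<Rightarrow> 'a)
    \<Rightarrow> 'c \<Rightarrow> 'c \<Rightarrow> 'a" where
  "cov_deriv G f Y q u =
     frechet_derivative Y (at q) u + christoffel G (f q) (frechet_derivative f (at q) u) (Y q)"

text \<open>\<open>R(u, v)w = D\<^sub>u D\<^sub>v w - D\<^sub>v D\<^sub>u w\<close>, where \<open>u\<close>, \<open>v\<close>, \<open>w\<close> are extended to vector fields with
  constant coefficients, so that the Lie bracket \<open>[u, v]\<close> vanishes.\<close>

definition curvature ::
  "('a::euclidean_space \<Rightarrow> 'a \<Rightarrow> 'a \<Rightarrow> real) \<Rightarrow> 'a \<Rightarrow> 'a \<Rightarrow> 'a \<Rightarrow> 'a \<Rightarrow> 'a" where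
  "curvature G p u v w =
     cov_deriv G id (\<lambda>q. cov_deriv G id (\<lambda>_. w) q v) p u
     - cov_deriv G id (\<lambda>q. cov_deriv G id (\<lambda>_. w) q u) p v"

definition sectional_curvature ::
  "('a::euclidean_space \<Rightarrow> 'a \<Rightarrow> 'a \<Rightarrow> real) \<Rightarrow> 'a \<Rightarrow> 'a \<Rightarrow> 'a \<Rightarrow> real" where
  "sectional_curvature G p u v =
     G p (curvature G p u v v) u / (G p u u * G p v v - (G p u v)\<^sup>2)"

section \<open>The ambient spaces\<close>

text \<open>\<open>\<real>\<^bsup>n+1\<^esup>\<close> is \<open>\<real>\<^sup>n \<times> \<real>\<close>, so \<open>snd\<close> is the coordinate with index \<open>n+1\<close>. The sign \<open>\<epsilon>\<close> is
  \<open>1\<close> for \<open>H\<^bsup>n+1\<^esup>\<close> and the Euclidean product, and \<open>-1\<close> for \<open>S\<^sub>1\<^bsup>n+1\<^esup>\<close> and the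
  Lorentz-Minkowski product. All notions of the following sections take it as first argument.\<close>

type_synonym 'n ambient = "(real^'n) \<times> real"

definition flat_form :: "real \<Rightarrow> 'n::finite ambient \<Rightarrow> 'n ambient \<Rightarrow> real" where
  "flat_form \<epsilon> a b = fst a \<bullet> fst b + \<epsilon> * (snd a * snd b)"

definition half_space_metric ::
  "real \<Rightarrow> 'n::finite ambient \<Rightarrow> 'n ambient \<Rightarrow> 'n ambient \<Rightarrow> real" where
  "half_space_metric \<epsilon> y a b = flat_form \<epsilon> a b / (snd y)\<^sup>2"

section \<open>Hypersurfaces in a coordinate patch\<close>

text \<open>In this section \<open>X\<close> and \<open>\<nu>\<close> are the immersion and the normal Gauss map expressed in a chart
  of \<open>M\<close>, \<open>q\<close> is a point of the range of the chart, and tangent vectors of \<open>M\<close> are represented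
  by their coordinates \<open>u\<close>, \<open>v\<close> in the chart.\<close>

definition first_form ::
  "real \<Rightarrow> (real^'n \<Rightarrow> 'n::finite ambient) \<Rightarrow> real^'n \<Rightarrow> real^'n \<Rightarrow> real^'n \<Rightarrow> real" where
  "first_form \<epsilon> X q u v =
     half_space_metric \<epsilon> (X q) (frechet_derivative X (at q) u) (frechet_derivative X (at q) v)"

text \<open>The Gauss formula \<open>D\<^sub>u v = \<nabla>\<^sub>u v + II(u, v) N\<close> for coordinate vectors extended with constant
  coefficients (\<open>D\<^sub>u v - \<nabla>\<^sub>u v\<close> does not depend on the extension), with \<open>N = x\<^bsub>n+1\<^esub> \<eta>\<close>.\<close>

definition second_form ::
  "real \<Rightarrow> (real^'n \<Rightarrow> 'n::finite ambient) \<Rightarrow> (real^'n \<Rightarrow> 'n ambient)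
    \<Rightarrow> real^'n \<Rightarrow> real^'n \<Rightarrow> real^'n \<Rightarrow> real" where
  "second_form \<epsilon> X \<nu> q u v = (THE h.
     cov_deriv (half_space_metric \<epsilon>) X (\<lambda>p. frechet_derivative X (at p) v) q u =
     frechet_derivative X (at q) (cov_deriv (first_form \<epsilon> X) id (\<lambda>_. v) q u)
       + h *\<^sub>R (snd (X q) *\<^sub>R \<nu> q))"

definition fourth_form ::
  "real \<Rightarrow> (real^'n \<Rightarrow> 'n::finite ambient) \<Rightarrow> real^'n \<Rightarrow> real^'n \<Rightarrow> real^'n \<Rightarrow> real" where
  "fourth_form \<epsilon> \<nu> q u v =
     flat_form \<epsilon> (frechet_derivative \<nu> (at q) u) (frechet_derivative \<nu> (at q) v)"

definition principal_direction_space ::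
  "real \<Rightarrow> (real^'n \<Rightarrow> 'n::finite ambient) \<Rightarrow> (real^'n \<Rightarrow> 'n ambient)
    \<Rightarrow> real^'n \<Rightarrow> real \<Rightarrow> (real^'n) set" where
  "principal_direction_space \<epsilon> X \<nu> q \<kappa> =
     {u. \<forall>v. second_form \<epsilon> X \<nu> q u v = \<kappa> * first_form \<epsilon> X q u v}"

definition principal_curvatures ::
  "real \<Rightarrow> (real^'n \<Rightarrow> 'n::finite ambient) \<Rightarrow> (real^'n \<Rightarrow> 'n ambient) \<Rightarrow> real^'n \<Rightarrow> real set" where
  "principal_curvatures \<epsilon> X \<nu> q = {\<kappa>. \<exists>u\<in>principal_direction_space \<epsilon> X \<nu> q \<kappa>. u \<noteq> 0}"

definition umbilic ::
  "real \<Rightarrow> (real^'n \<Rightarrow> 'n::finite ambient) \<Rightarrow> (real^'n \<Rightarrow> 'n ambient) \<Rightarrow> real^'n \<Rightarrow> bool" where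
  "umbilic \<epsilon> X \<nu> q \<longleftrightarrow> (\<exists>\<kappa>. \<forall>u v. second_form \<epsilon> X \<nu> q u v = \<kappa> * first_form \<epsilon> X q u v)"

section \<open>Immersed hypersurfaces and their normal Gauss maps\<close>

definition immersed_in_half_space ::
  "('m, 'n::finite) chart set \<Rightarrow> ('m \<Rightarrow> 'n ambient) \<Rightarrow> bool" where
  "immersed_in_half_space A x \<longleftrightarrow>
     smooth_map A x \<and> (\<forall>p. snd (x p) > 0) \<and>
     (\<forall>c\<in>A. \<forall>q\<in>chart_range c. inj (frechet_derivative (x \<circ> chart_inv c) (at q)))"

definition space_like :: "real \<Rightarrow> ('m, 'n::finite) chart set \<Rightarrow> ('m \<Rightarrow> 'n ambient) \<Rightarrow> bool" where
  "space_like \<epsilon> A x \<longleftrightarrow>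
     (\<forall>c\<in>A. \<forall>q\<in>chart_range c. \<forall>u. u \<noteq> 0 \<longrightarrow> first_form \<epsilon> (x \<circ> chart_inv c) q u u > 0)"

text \<open>\<open>\<eta>\<close> is the normal Gauss map of a smooth unit normal field \<open>N = x\<^bsub>n+1\<^esub> \<eta>\<close> on \<open>M\<close>.\<close>

definition normal_gauss_map ::
  "real \<Rightarrow> ('m, 'n::finite) chart set \<Rightarrow> ('m \<Rightarrow> 'n ambient) \<Rightarrow> ('m \<Rightarrow> 'n ambient) \<Rightarrow> bool" where
  "normal_gauss_map \<epsilon> A x \<eta> \<longleftrightarrow>
     smooth_map A \<eta> \<and> (\<forall>p. flat_form \<epsilon> (\<eta> p) (\<eta> p) = \<epsilon>) \<and>
     (\<forall>c\<in>A. \<forall>q\<in>chart_range c. \<forall>u.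
        half_space_metric \<epsilon> (x (chart_inv c q))
          (snd (x (chart_inv c q)) *\<^sub>R \<eta> (chart_inv c q))
          (frechet_derivative (x \<circ> chart_inv c) (at q) u) = 0)"

definition without_umbilics ::
  "real \<Rightarrow> ('m, 'n::finite) chart set \<Rightarrow> ('m \<Rightarrow> 'n ambient) \<Rightarrow> ('m \<Rightarrow> 'n ambient) \<Rightarrow> bool" where
  "without_umbilics \<epsilon> A x \<eta> \<longleftrightarrow>
     (\<forall>c\<in>A. \<forall>q\<in>chart_range c. \<not> umbilic \<epsilon> (x \<circ> chart_inv c) (\<eta> \<circ> chart_inv c) q)"

definition gauss_map_conformal ::
  "real \<Rightarrow> ('m, 'n::finite) chart set \<Rightarrow> ('m \<Rightarrow> 'n ambient) \<Rightarrow> ('m \<Rightarrow> 'n ambient) \<Rightarrow> bool" where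
  "gauss_map_conformal \<epsilon> A x \<eta> \<longleftrightarrow>
     (\<exists>\<rho>::'m \<Rightarrow> real. smooth_map A \<rho> \<and>
        (\<forall>c\<in>A. \<forall>q\<in>chart_range c. \<forall>u v.
           fourth_form \<epsilon> (\<eta> \<circ> chart_inv c) q u v =
           \<rho> (chart_inv c q) * second_form \<epsilon> (x \<circ> chart_inv c) (\<eta> \<circ> chart_inv c) q u v))"

end

theory Submission
  imports Defs
begin

text \<open>Let \<open>s = x\<^bsub>n+1\<^esub>\<close>, \<open>\<eta> = \<eta>\<^bsub>n+1\<^esub>\<close>, and let \<open>S\<close> be the shape operator, \<open>II(u, v) = I(Su, v)\<close>. The half
  space metric is conformal to the flat one, which gives \<open>d\<nu> = dX \<circ> (\<eta> - \<epsilon>S) / s\<close>, and therefore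
  \<open>IV(u, v) = I((\<eta> - \<epsilon>S)\<^sup>2u, v)\<close>. So \<open>IV = \<rho> II\<close> says that \<open>S\<close> satisfies the quadratic equation
  \<open>S\<^sup>2 - (\<rho> + 2\<epsilon>\<eta>)S + \<eta>\<^sup>2 = 0\<close>. As \<open>S\<close> is self-adjoint and not a multiple of the identity, this
  holds for some \<open>\<rho>\<close> if and only if \<open>S\<close> has exactly two eigenvalues \<open>\<kappa>\<close>, \<open>\<mu>\<close> and \<open>\<kappa>\<mu> = \<eta>\<^sup>2\<close>. By the
  Gauss equation the plane of two principal vectors for \<open>\<kappa>\<close> and \<open>\<mu>\<close> has sectional curvature
  \<open>-\<epsilon> + \<epsilon>\<kappa>\<mu>\<close>.\<close>

section \<open>Calculus of smooth maps\<close>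

text \<open>The equivalence is pointwise, while \<open>gauss_map_conformal\<close> asks for a single
  smooth \<rho> on the whole manifold. At a non-umbilic point II does not vanish, so \<rho> is
  unique there; uniqueness makes the values found in different charts agree, and a formula in the
  components of both forms makes them smooth. The sign \<epsilon> enters through
  \<open>\<epsilon>\<^sup>2 = 1\<close>, and the first form is positive definite in both cases, so
  one computation serves both ambient spaces. The delicate point of the Gauss equation is that
  Christoffel forms are definite descriptions and derivatives are choices. Each Christoffel form has
  to be recognised from an explicit candidate, and the curvature carries information only once the
  intrinsic one is known to be differentiable. It arises as the tangential part of an ambient
  vector, that is, as the solution of a linear system with the Gram matrix of the coordinate frame,
  and Cramer's rule supplies differentiability. Its derivative is never computed: differentiating
  the Gauss formula eliminates it.\<close>

abbreviation pd :: "('a::real_normed_vector \<Rightarrow> 'b::real_normed_vector) \<Rightarrow> 'a \<Rightarrow> 'a \<Rightarrow> 'b" where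
  "pd f v \<equiv> (\<lambda>x. frechet_derivative f (at x) v)"

lemma differentiable_cong_open:
  assumes "open S" "x \<in> S" "\<And>y. y \<in> S \<Longrightarrow> f y = g y" "f differentiable (at x)"
  shows "g differentiable (at x)"
  using assms unfolding differentiable_def
  by (metis has_derivative_transform_within_open)

text \<open>A derivative is a choice from the set of all derivatives at the point, and this set
  depends only on the germ of the function; so the equality also holds where neither function is
  differentiable.\<close>

lemma frechet_derivative_cong_open:
  assumes "open S" "x \<in> S" "\<And>y. y \<in> S \<Longrightarrow> f y = g y"
  shows "frechet_derivative f (at x) = frechet_derivative g (at x)"
proof -
  have "(f has_derivative D) (at x) \<longleftrightarrow> (g has_derivative D) (at x)" for D
    using assms has_derivative_transform_within_open by metis
  then show ?thesis
    by (simp add: frechet_derivative_def)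
qed

lemma Ck_on_cong:
  assumes "open S" "\<And>x. x \<in> S \<Longrightarrow> f x = g x" "Ck_on k S f"
  shows "Ck_on k S g"
  using assms
proof (induction k arbitrary: f g)
  case 0
  then show ?case by (simp cong: continuous_on_cong)
next
  case (Suc k)
  have "g differentiable (at x)" if "x \<in> S" for x
    using differentiable_cong_open[OF Suc.prems(1) that Suc.prems(2)] Suc.prems(3) that by auto
  moreover have "Ck_on k S (pd g v)" for v
    using Suc.IH[OF Suc.prems(1), of "pd f v" "pd g v"] Suc.prems(2,3)
      frechet_derivative_cong_open[OF Suc.prems(1) _ Suc.prems(2)] by simp
  ultimately show ?case by simp
qed

lemma Ck_on_SucD: "Ck_on (Suc k) S f \<Longrightarrow> Ck_on k S f"
proof (induction k arbitrary: f)
  case 0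
  then show ?case
    by (auto intro!: continuous_at_imp_continuous_on differentiable_imp_continuous_within)
next
  case (Suc k)
  from Suc.prems have "\<forall>v. Ck_on (Suc k) S (pd f v)"
    by (subst (asm) Ck_on.simps(2)) blast
  with Suc show ?case by simp
qed

lemma Ck_on_bounded_linear:
  assumes L: "bounded_linear L" and S: "open S" and f: "Ck_on k S f"
  shows "Ck_on k S (\<lambda>x. L (f x))"
  using f
proof (induction k arbitrary: f)
  case 0
  then show ?case using bounded_linear.continuous_on[OF L] by simp
next
  case (Suc k)
  have d: "((\<lambda>x. L (f x)) has_derivative (\<lambda>v. L (pd f v x))) (at x)" if "x \<in> S" for x
    using bounded_linear.has_derivative[OF L, of f "frechet_derivative f (at x)"] Suc.prems that
    by (simp add: frechet_derivative_works)
  have "Ck_on k S (pd (\<lambda>x. L (f x)) v)" for v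
    by (rule Ck_on_cong[OF S _ Suc.IH[of "pd f v"]])
      (use frechet_derivative_at[OF d] Suc.prems in \<open>auto simp: fun_eq_iff\<close>)
  then show ?case using d by (auto simp: differentiable_def)
qed

lemma Ck_on_add:
  assumes S: "open S" and "Ck_on k S f" "Ck_on k S g"
  shows "Ck_on k S (\<lambda>x. f x + g x)"
  using assms(2,3)
proof (induction k arbitrary: f g)
  case 0
  then show ?case by (simp add: continuous_on_add)
next
  case (Suc k)
  have d: "((\<lambda>x. f x + g x) has_derivative (\<lambda>v. pd f v x + pd g v x)) (at x)" if "x \<in> S" for x
    using Suc.prems that by (intro has_derivative_add) (simp_all add: frechet_derivative_works)
  have "Ck_on k S (pd (\<lambda>x. f x + g x) v)" for v
    by (rule Ck_on_cong[OF S _ Suc.IH[of "pd f v" "pd g v"]])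
      (use frechet_derivative_at[OF d] Suc.prems in \<open>auto simp: fun_eq_iff\<close>)
  then show ?case using d by (auto simp: differentiable_def)
qed

lemma Ck_on_bounded_bilinear:
  assumes B: "bounded_bilinear B" and S: "open S" and "Ck_on k S f" "Ck_on k S g"
  shows "Ck_on k S (\<lambda>x. B (f x) (g x))"
  using assms(3,4)
proof (induction k arbitrary: f g)
  case 0
  then show ?case by (simp add: bounded_bilinear.continuous_on[OF B])
next
  case (Suc k)
  have d: "((\<lambda>x. B (f x) (g x)) has_derivative (\<lambda>v. B (f x) (pd g v x) + B (pd f v x) (g x))) (at x)"
    if "x \<in> S" for x
    using Suc.prems that
    by (intro bounded_bilinear.FDERIV[OF B]) (simp_all add: frechet_derivative_works)
  have "Ck_on k S (pd (\<lambda>x. B (f x) (g x)) v)" for v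
  proof (rule Ck_on_cong[OF S])
    show "Ck_on k S (\<lambda>x. B (f x) (pd g v x) + B (pd f v x) (g x))"
      using Suc.prems by (intro Ck_on_add S Suc.IH) (auto intro: Ck_on_SucD simp del: Ck_on.simps(2) simp: Ck_on.simps(2)[of k S f] Ck_on.simps(2)[of k S g])
  qed (use frechet_derivative_at[OF d] in \<open>auto simp: fun_eq_iff\<close>)
  then show ?case using d by (auto simp: differentiable_def)
qed

lemma Ck_on_const: "Ck_on k S (\<lambda>x. c)"
  by (induction k arbitrary: c) auto

text \<open>The derivative of 1/f is a product of 1/f, 1/f and f', so regularity of 1/f at one level
  feeds the next one; hence an induction with \<open>f\<close> fixed.\<close>

lemma Ck_on_inverse:
  fixes f :: "'a::real_normed_vector \<Rightarrow> real"
  assumes S: "open S" and nz: "\<And>x. x \<in> S \<Longrightarrow> f x \<noteq> 0" and f: "Ck_on k S f"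
  shows "Ck_on k S (\<lambda>x. inverse (f x))"
  using f
proof (induction k)
  case 0
  then show ?case using nz by (auto intro: continuous_on_inverse)
next
  case (Suc k)
  have IH: "Ck_on k S (\<lambda>x. inverse (f x))"
    using Suc Ck_on_SucD by blast
  have d: "((\<lambda>x. inverse (f x)) has_derivative
      (\<lambda>v. (- 1) * (inverse (f x) * pd f v x * inverse (f x)))) (at x)" if "x \<in> S" for x
    using Suc.prems that nz by (auto intro!: derivative_eq_intros simp: frechet_derivative_works)
  note mult = Ck_on_bounded_bilinear[OF bounded_bilinear_mult S]
  have "Ck_on k S (pd (\<lambda>x. inverse (f x)) v)" for v
  proof (rule Ck_on_cong[OF S])
    show "Ck_on k S (\<lambda>x. (- 1) * (inverse (f x) * pd f v x * inverse (f x)))"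
      using Suc.prems by (intro mult IH Ck_on_const) auto
  qed (use frechet_derivative_at[OF d] in \<open>auto simp: fun_eq_iff\<close>)
  then show ?case using d by (auto simp: differentiable_def)
qed

lemma smooth_on_differentiable: "smooth_on S f \<Longrightarrow> x \<in> S \<Longrightarrow> f differentiable (at x)"
  unfolding smooth_on_def by (metis Ck_on.simps(2))

lemma smooth_on_has_derivative:
  "smooth_on S f \<Longrightarrow> x \<in> S \<Longrightarrow> (f has_derivative (\<lambda>v. pd f v x)) (at x)"
  using smooth_on_differentiable frechet_derivative_works by metis

lemma smooth_on_pd: "smooth_on S f \<Longrightarrow> smooth_on S (pd f v)"
  unfolding smooth_on_def by (metis Ck_on.simps(2))

lemma smooth_on_continuous: "smooth_on S f \<Longrightarrow> continuous_on S f"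
  unfolding smooth_on_def by (metis Ck_on.simps(1))

lemma smooth_on_cong:
  "open S \<Longrightarrow> (\<And>x. x \<in> S \<Longrightarrow> f x = g x) \<Longrightarrow> smooth_on S f \<Longrightarrow> smooth_on S g"
  unfolding smooth_on_def using Ck_on_cong by metis

lemma smooth_on_bounded_linear:
  "bounded_linear L \<Longrightarrow> open S \<Longrightarrow> smooth_on S f \<Longrightarrow> smooth_on S (\<lambda>x. L (f x))"
  unfolding smooth_on_def by (simp add: Ck_on_bounded_linear)

lemma smooth_on_bounded_bilinear:
  "bounded_bilinear B \<Longrightarrow> open S \<Longrightarrow> smooth_on S f \<Longrightarrow> smooth_on S g \<Longrightarrow>
    smooth_on S (\<lambda>x. B (f x) (g x))"
  unfolding smooth_on_def by (simp add: Ck_on_bounded_bilinear)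

lemmas smooth_on_mult = smooth_on_bounded_bilinear[OF bounded_bilinear_mult]

lemma smooth_on_add:
  "open S \<Longrightarrow> smooth_on S f \<Longrightarrow> smooth_on S g \<Longrightarrow> smooth_on S (\<lambda>x. f x + g x)"
  unfolding smooth_on_def by (simp add: Ck_on_add)

lemma smooth_on_const: "smooth_on S (\<lambda>x. c)"
  unfolding smooth_on_def by (simp add: Ck_on_const)

lemma smooth_on_inverse:
  fixes f :: "'a::real_normed_vector \<Rightarrow> real"
  shows "open S \<Longrightarrow> (\<And>x. x \<in> S \<Longrightarrow> f x \<noteq> 0) \<Longrightarrow> smooth_on S f \<Longrightarrow> smooth_on S (\<lambda>x. inverse (f x))"
  unfolding smooth_on_def by (simp add: Ck_on_inverse)

lemma smooth_on_sum:
  "open S \<Longrightarrow> (\<And>i. i \<in> I \<Longrightarrow> smooth_on S (f i)) \<Longrightarrow> smooth_on S (\<lambda>x. \<Sum>i\<in>I. f i x)"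
  by (induction I rule: infinite_finite_induct) (auto intro: smooth_on_const smooth_on_add)

section \<open>Symmetry of second derivatives\<close>

lemma second_difference_mvt:
  fixes F :: "'a::real_normed_vector \<Rightarrow> real"
  assumes "smooth_on S F" and h: "0 < h" and
    sub: "\<And>s t. 0 \<le> s \<Longrightarrow> s \<le> h \<Longrightarrow> 0 \<le> t \<Longrightarrow> t \<le> h \<Longrightarrow> p + s *\<^sub>R v + t *\<^sub>R w \<in> S"
  obtains s t where "0 \<le> s" "s \<le> h" "0 \<le> t" "t \<le> h"
    "F (p + h *\<^sub>R v + h *\<^sub>R w) - F (p + h *\<^sub>R v) - F (p + h *\<^sub>R w) + F p
      = h\<^sup>2 * pd (pd F v) w (p + s *\<^sub>R v + t *\<^sub>R w)"
proof -
  have F: "(F has_derivative (\<lambda>z. pd F z x)) (at x)"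
    and Fv: "(pd F v has_derivative (\<lambda>z. pd (pd F v) z x)) (at x)" if "x \<in> S" for x
    using smooth_on_has_derivative assms(1) smooth_on_pd that by blast+
  have lin: "linear (\<lambda>z. pd F z x)" "linear (\<lambda>z. pd (pd F v) z x)" if "x \<in> S" for x
    using F[OF that] Fv[OF that] by (simp_all add: has_derivative_linear)
  have dline: "((\<lambda>s. p + s *\<^sub>R v + t *\<^sub>R w) has_derivative (\<lambda>d. d *\<^sub>R v)) (at s)" for s t
    by (auto intro!: derivative_eq_intros)
  have dline2: "((\<lambda>t. p + s *\<^sub>R v + t *\<^sub>R w) has_derivative (\<lambda>d. d *\<^sub>R w)) (at t)" for s t
    by (auto intro!: derivative_eq_intros)
  have line: "((\<lambda>s. F (p + s *\<^sub>R v + t *\<^sub>R w)) has_real_derivative pd F v (p + s *\<^sub>R v + t *\<^sub>R w)) (at s)"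
    if "0 \<le> s" "s \<le> h" "0 \<le> t" "t \<le> h" for s t
    using has_derivative_compose[OF dline F[OF sub[OF that]]] linear_cmul[OF lin(1)[OF sub[OF that]]]
    by (simp add: has_field_derivative_def mult_commute_abs)
  have line2: "((\<lambda>t. pd F v (p + s *\<^sub>R v + t *\<^sub>R w)) has_real_derivative pd (pd F v) w (p + s *\<^sub>R v + t *\<^sub>R w)) (at t)"
    if "0 \<le> s" "s \<le> h" "0 \<le> t" "t \<le> h" for s t
    using has_derivative_compose[OF dline2 Fv[OF sub[OF that]]] linear_cmul[OF lin(2)[OF sub[OF that]]]
    by (simp add: has_field_derivative_def mult_commute_abs)
  \<comment> \<open>The second difference is the increment in direction \<open>v\<close> of the
    first difference in direction \<open>w\<close>; the mean value theorem is applied first along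
    \<open>v\<close>, then along \<open>w\<close>.\<close>
  let ?g = "\<lambda>s. F (p + s *\<^sub>R v + h *\<^sub>R w) - F (p + s *\<^sub>R v + 0 *\<^sub>R w)"
  have "\<exists>s. 0 < s \<and> s < h \<and> ?g h - ?g 0 =
      (h - 0) * (pd F v (p + s *\<^sub>R v + h *\<^sub>R w) - pd F v (p + s *\<^sub>R v + 0 *\<^sub>R w))"
    using h by (intro MVT2 DERIV_diff line) auto
  then obtain s where s: "0 < s" "s < h" "?g h - ?g 0 =
      (h - 0) * (pd F v (p + s *\<^sub>R v + h *\<^sub>R w) - pd F v (p + s *\<^sub>R v + 0 *\<^sub>R w))" by blast
  have "\<exists>t. 0 < t \<and> t < h \<and> pd F v (p + s *\<^sub>R v + h *\<^sub>R w) - pd F v (p + s *\<^sub>R v + 0 *\<^sub>R w)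
      = (h - 0) * pd (pd F v) w (p + s *\<^sub>R v + t *\<^sub>R w)"
    using h s by (intro MVT2 line2) auto
  then obtain t where "0 < t" "t < h" "pd F v (p + s *\<^sub>R v + h *\<^sub>R w) - pd F v (p + s *\<^sub>R v + 0 *\<^sub>R w)
      = (h - 0) * pd (pd F v) w (p + s *\<^sub>R v + t *\<^sub>R w)" by blast
  with s show ?thesis
    by (intro that[of s t]) (auto simp: power2_eq_square algebra_simps)
qed

text \<open>The second difference over a parallelogram is symmetric in \<open>v\<close> and
  \<open>w\<close>. Evaluated in both orders it yields the two mixed derivatives at points close to
  \<open>p\<close>, so by continuity they cannot differ at \<open>p\<close>; \<open>e\<close> is
  half of the supposed gap.\<close>

lemma second_derivative_symmetric_real:
  fixes F :: "'a::real_normed_vector \<Rightarrow> real"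
  assumes F: "smooth_on S F" and S: "open S" and p: "p \<in> S"
  shows "pd (pd F v) w p = pd (pd F w) v p"
proof (rule ccontr)
  assume neq: "pd (pd F v) w p \<noteq> pd (pd F w) v p"
  define e where "e = \<bar>pd (pd F v) w p - pd (pd F w) v p\<bar> / 2"
  have e: "e > 0" using neq by (simp add: e_def)
  have "isCont (pd (pd F v) w) p" "isCont (pd (pd F w) v) p"
    using smooth_on_continuous[OF smooth_on_pd[OF smooth_on_pd[OF F]]] continuous_on_interior p S
    by (metis interior_open)+
  then obtain d1 d2 where d: "d1 > 0" "d2 > 0"
    "\<And>y. dist y p < d1 \<Longrightarrow> dist (pd (pd F v) w y) (pd (pd F v) w p) < e"
    "\<And>y. dist y p < d2 \<Longrightarrow> dist (pd (pd F w) v y) (pd (pd F w) v p) < e"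
    unfolding continuous_at_eps_delta using e by metis
  obtain d3 where d3: "d3 > 0" "ball p d3 \<subseteq> S"
    using S p open_contains_ball by blast
  define r where "r = min d1 (min d2 d3)"
  \<comment> \<open>This size keeps the whole parallelogram within distance \<open>r\<close> of
    \<open>p\<close>; the summand 1 covers the case that both vectors are zero.\<close>
  define h where "h = r / (norm v + norm w + 1)"
  have r: "r > 0" using d d3 by (simp add: r_def)
  have c: "norm v + norm w + 1 > 0"
    by (smt (verit) norm_ge_zero)
  have h: "h > 0" using r c by (simp add: h_def)
  have hr: "h * (norm v + norm w) < r"
  proof -
    have "h * (norm v + norm w) < h * (norm v + norm w + 1)" using h by simp
    also have "\<dots> = r" using c by (simp add: h_def)
    finally show ?thesis .
  qed
  have near: "dist (p + s *\<^sub>R v + t *\<^sub>R w) p < r" "dist (p + t *\<^sub>R w + s *\<^sub>R v) p < r"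
    if "0 \<le> s" "s \<le> h" "0 \<le> t" "t \<le> h" for s t
  proof -
    have "norm (s *\<^sub>R v + t *\<^sub>R w) \<le> s * norm v + t * norm w"
      using norm_triangle_ineq[of "s *\<^sub>R v" "t *\<^sub>R w"] that by simp
    also have "\<dots> \<le> h * norm v + h * norm w"
      using that by (intro add_mono mult_right_mono) auto
    finally show "dist (p + s *\<^sub>R v + t *\<^sub>R w) p < r" "dist (p + t *\<^sub>R w + s *\<^sub>R v) p < r"
      using hr by (simp_all add: dist_norm algebra_simps)
  qed
  have sub: "p + s *\<^sub>R v + t *\<^sub>R w \<in> S" "p + t *\<^sub>R w + s *\<^sub>R v \<in> S"
    if "0 \<le> s" "s \<le> h" "0 \<le> t" "t \<le> h" for s t
    using near[OF that] d3 by (auto simp: r_def subset_iff dist_commute)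
  obtain s t where st: "0 \<le> s" "s \<le> h" "0 \<le> t" "t \<le> h"
    "F (p + h *\<^sub>R v + h *\<^sub>R w) - F (p + h *\<^sub>R v) - F (p + h *\<^sub>R w) + F p
      = h\<^sup>2 * pd (pd F v) w (p + s *\<^sub>R v + t *\<^sub>R w)"
    using second_difference_mvt[OF F h sub(1)] by blast
  obtain s' t' where st': "0 \<le> s'" "s' \<le> h" "0 \<le> t'" "t' \<le> h"
    "F (p + h *\<^sub>R w + h *\<^sub>R v) - F (p + h *\<^sub>R w) - F (p + h *\<^sub>R v) + F p
      = h\<^sup>2 * pd (pd F w) v (p + s' *\<^sub>R w + t' *\<^sub>R v)"
    using second_difference_mvt[OF F h sub(2)] by blast
  have "h\<^sup>2 * pd (pd F v) w (p + s *\<^sub>R v + t *\<^sub>R w) = h\<^sup>2 * pd (pd F w) v (p + s' *\<^sub>R w + t' *\<^sub>R v)"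
    using st(5) st'(5) unfolding add.commute[of "p + h *\<^sub>R w" "h *\<^sub>R v"]
    by (simp add: algebra_simps)
  then have "pd (pd F v) w (p + s *\<^sub>R v + t *\<^sub>R w) = pd (pd F w) v (p + s' *\<^sub>R w + t' *\<^sub>R v)"
    using h by simp
  moreover have "dist (pd (pd F v) w (p + s *\<^sub>R v + t *\<^sub>R w)) (pd (pd F v) w p) < e"
    using near(1)[OF st(1-4)] by (intro d(3)) (simp add: r_def)
  moreover have "dist (pd (pd F w) v (p + s' *\<^sub>R w + t' *\<^sub>R v)) (pd (pd F w) v p) < e"
    using near(2)[OF st'(3,4,1,2)] by (intro d(4)) (simp add: r_def)
  ultimately show False
    unfolding e_def dist_real_def by (smt (verit) field_sum_of_halves)
qed

lemma second_derivative_symmetric: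
  fixes F :: "'a::real_normed_vector \<Rightarrow> 'b::euclidean_space"
  assumes F: "smooth_on S F" and S: "open S" and p: "p \<in> S"
  shows "pd (pd F v) w p = pd (pd F w) v p"
proof (rule euclidean_eqI)
  fix b :: 'b
  note bl = bounded_linear_inner_left[of b]
  have 1: "pd (\<lambda>x. G x \<bullet> b) v x = pd G v x \<bullet> b" if "smooth_on S G" "x \<in> S" for G :: "'a \<Rightarrow> 'b" and v x
    using frechet_derivative_at[OF bounded_linear.has_derivative[OF bl smooth_on_has_derivative[OF that]]]
    by (simp add: fun_eq_iff)
  have 2: "pd (pd (\<lambda>x. F x \<bullet> b) v) w p = pd (pd F v) w p \<bullet> b" for v w
  proof -
    have "pd (pd (\<lambda>x. F x \<bullet> b) v) w p = pd (\<lambda>x. pd F v x \<bullet> b) w p"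
      by (rule fun_cong[OF frechet_derivative_cong_open[OF S p]]) (rule 1[OF F])
    then show ?thesis using 1[OF smooth_on_pd[OF F] p] by simp
  qed
  show "pd (pd F v) w p \<bullet> b = pd (pd F w) v p \<bullet> b"
    using second_derivative_symmetric_real[OF smooth_on_bounded_linear[OF bl S F] S p] 2 by simp
qed

section \<open>Differentiable dependence of the solution of a linear system\<close>

lemma differentiable_prod_fun:
  fixes f :: "'i \<Rightarrow> 'a::real_normed_vector \<Rightarrow> real"
  assumes "\<And>i. i \<in> I \<Longrightarrow> f i differentiable (at x)"
  shows "(\<lambda>x. \<Prod>i\<in>I. f i x) differentiable (at x)"
  using assms by (induction I rule: infinite_finite_induct) auto

lemma differentiable_det:
  fixes M :: "'a::real_normed_vector \<Rightarrow> real^'n^'n"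
  assumes "\<And>i j. (\<lambda>x. M x $ i $ j) differentiable (at x)"
  shows "(\<lambda>x. det (M x)) differentiable (at x)"
  unfolding det_def
  by (intro differentiable_sum ballI differentiable_mult differentiable_const differentiable_prod_fun
      assms finite_permutations) auto

lemma differentiable_vec_lambda:
  fixes f :: "'a::real_normed_vector \<Rightarrow> real^'n"
  assumes "\<And>i. (\<lambda>x. f x $ i) differentiable (at x)"
  shows "f differentiable (at x)"
proof -
  have "(\<lambda>x. \<Sum>i\<in>UNIV. f x $ i *\<^sub>R axis i (1::real)) differentiable (at x)"
    by (intro differentiable_sum ballI differentiable_scaleR differentiable_const assms) auto
  then show ?thesis by (simp add: basis_expansion flip: scalar_mult_eq_scaleR)
qed

text \<open>Cramer's rule writes the solution as a quotient of determinants, which are polynomials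
  in the entries.\<close>

lemma differentiable_linear_solution:
  fixes M :: "'a::real_normed_vector \<Rightarrow> real^'n^'n" and b y :: "'a \<Rightarrow> real^'n"
  assumes S: "open S" "x \<in> S" and nz: "\<And>p. p \<in> S \<Longrightarrow> det (M p) \<noteq> 0"
    and eq: "\<And>p. p \<in> S \<Longrightarrow> M p *v y p = b p"
    and M: "\<And>i j. (\<lambda>p. M p $ i $ j) differentiable (at x)"
    and b: "\<And>i. (\<lambda>p. b p $ i) differentiable (at x)"
  shows "y differentiable (at x)"
proof (rule differentiable_cong_open[OF S])
  show "(\<chi> k. det (\<chi> i j. if j = k then b p $ i else M p $ i $ j) / det (M p)) = y p" if "p \<in> S" for p
    using iffD1[OF cramer[OF nz[OF that]] eq[OF that]] by (rule sym)
  have "(\<lambda>p. det (\<chi> i j. if j = k then b p $ i else M p $ i $ j)) differentiable (at x)" for k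
  proof (rule differentiable_det)
    show "(\<lambda>p. (\<chi> i j. if j = k then b p $ i else M p $ i $ j) $ i $ j) differentiable (at x)" for i j
      using M b by (cases "j = k") simp_all
  qed
  then have "(\<lambda>p. det (\<chi> i j. if j = k then b p $ i else M p $ i $ j) / det (M p)) differentiable (at x)" for k
    using differentiable_det[OF M] nz[OF S(2)] by (intro differentiable_divide)
  then show "(\<lambda>p. \<chi> k. det (\<chi> i j. if j = k then b p $ i else M p $ i $ j) / det (M p)) differentiable (at x)"
    by (intro differentiable_vec_lambda) simp
qed

section \<open>Christoffel forms\<close>

text \<open>The uniqueness half of the fundamental theorem of Riemannian geometry: it turns the
  definite description into a candidate to be checked. The hypothesis is nondegeneracy rather than
  definiteness, because the half-space metric is Lorentzian for \<epsilon> = -1.\<close>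

lemma christoffel_eqI:
  assumes G: "bilinear (G p)" "\<And>a b. G p a b = G p b a"
    and nondeg: "\<And>a. (\<And>b. G p a b = 0) \<Longrightarrow> a = 0"
    and B: "bilinear B" "\<And>u v. B u v = B v u"
    and compat: "\<And>u v w. frechet_derivative (\<lambda>q. G q v w) (at p) u = G p (B u v) w + G p v (B u w)"
  shows "christoffel G p = B"
  unfolding christoffel_def
proof (rule the_equality)
  fix B'
  assume B': "bilinear B' \<and> (\<forall>u v. B' u v = B' v u) \<and>
     (\<forall>u v w. frechet_derivative (\<lambda>q. G q v w) (at p) u = G p (B' u v) w + G p v (B' u w))"
  \<comment> \<open>a form which is symmetric in its first two and antisymmetric in its last two arguments vanishes\<close>
  define T where "T u v w = G p (B' u v - B u v) w" for u v w
  have sym: "T u v w = T v u w" for u v w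
    using B B' unfolding T_def by metis
  have asym: "T u v w = - T u w v" for u v w
    unfolding T_def using compat[of v w u] B' G(2)[of v] by (simp add: bilinear_lsub[OF G(1)])
  \<comment> \<open>Using the two symmetries alternately, three times each, returns to
    \<open>T u v w\<close> with an odd number of signs.\<close>
  have "T u v w = 0" for u v w
    using sym asym by (smt (verit))
  then have "B' u v - B u v = 0" for u v
    using nondeg unfolding T_def by blast
  then show "B' = B" by (simp add: fun_eq_iff)
qed (use B compat in blast)

section \<open>The flat form and the connection of the half space\<close>

lemma bilinear_flat_form: "bilinear (flat_form \<epsilon>)"
  unfolding bilinear_def linear_iff flat_form_def by (auto simp: inner_simps algebra_simps)

lemma flat_form_sym: "flat_form \<epsilon> a b = flat_form \<epsilon> b a"
  by (simp add: flat_form_def inner_commute mult.commute)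

lemmas flat_form_simps =
  bilinear_ladd[OF bilinear_flat_form] bilinear_radd[OF bilinear_flat_form]
  bilinear_lsub[OF bilinear_flat_form] bilinear_rsub[OF bilinear_flat_form]
  bilinear_lmul[OF bilinear_flat_form] bilinear_rmul[OF bilinear_flat_form]
  bilinear_lneg[OF bilinear_flat_form] bilinear_rneg[OF bilinear_flat_form]
  bilinear_lzero[OF bilinear_flat_form] bilinear_rzero[OF bilinear_flat_form]

lemma bounded_bilinear_flat_form: "bounded_bilinear (flat_form \<epsilon>)"
  using bilinear_conv_bounded_bilinear bilinear_flat_form by blast

lemma flat_form_nondegenerate:
  assumes "\<epsilon> \<noteq> 0" "\<And>b. flat_form \<epsilon> a b = 0"
  shows "a = 0"
  using assms(1) assms(2)[of "(fst a, 0)"] assms(2)[of "(0, snd a)"]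
  by (auto simp: flat_form_def prod_eq_iff)

text \<open>The connection of a conformally flat metric: for exp(2f) times the flat form it is df(a)
  b + df(b) a - F(a, b) grad f, here with f = - log s for the height s. The vector (0, \<epsilon>)
  is the gradient of the height with respect to the flat form.\<close>

definition half_space_christoffel ::
  "real \<Rightarrow> 'n::finite ambient \<Rightarrow> 'n ambient \<Rightarrow> 'n ambient \<Rightarrow> 'n ambient" where
  "half_space_christoffel \<epsilon> y a b =
     inverse (snd y) *\<^sub>R (flat_form \<epsilon> a b *\<^sub>R (0, \<epsilon>) - snd a *\<^sub>R b - snd b *\<^sub>R a)"

lemma bilinear_half_space_christoffel: "bilinear (half_space_christoffel \<epsilon> y)"
  unfolding bilinear_def linear_iff half_space_christoffel_def
  by (auto simp: flat_form_simps scaleR_add_left scaleR_add_right algebra_simps)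

lemma half_space_christoffel_sym: "half_space_christoffel \<epsilon> y a b = half_space_christoffel \<epsilon> y b a"
  by (simp add: half_space_christoffel_def flat_form_sym[of \<epsilon> a b])

lemma flat_form_vertical: "\<epsilon>\<^sup>2 = 1 \<Longrightarrow> flat_form \<epsilon> (0, \<epsilon>) a = snd a"
  "\<epsilon>\<^sup>2 = 1 \<Longrightarrow> flat_form \<epsilon> a (0, \<epsilon>) = snd a"
  by (auto simp: flat_form_def power2_eq_square algebra_simps)

lemma christoffel_half_space:
  assumes e: "\<epsilon>\<^sup>2 = 1" and y: "snd y > 0"
  shows "christoffel (half_space_metric \<epsilon>) y = half_space_christoffel \<epsilon> y"
proof (rule christoffel_eqI)
  show "bilinear (half_space_metric \<epsilon> y)"
    unfolding bilinear_def linear_iff half_space_metric_def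
    by (auto simp: flat_form_simps add_divide_distrib)
  show "half_space_metric \<epsilon> y a b = half_space_metric \<epsilon> y b a" for a b
    by (simp add: half_space_metric_def flat_form_sym)
  show "a = 0" if "\<And>b. half_space_metric \<epsilon> y a b = 0" for a
  proof (rule flat_form_nondegenerate)
    show "\<epsilon> \<noteq> 0" using e by auto
    show "flat_form \<epsilon> a b = 0" for b
      using that[of b] y by (simp add: half_space_metric_def)
  qed
  fix u v w :: "'a ambient"
  have "((\<lambda>q. half_space_metric \<epsilon> q v w) has_derivative
      (\<lambda>u. - 2 * flat_form \<epsilon> v w * snd u * inverse (snd y) ^ 3)) (at y)"
    unfolding half_space_metric_def using y
    by (auto intro!: derivative_eq_intros simp: field_simps power2_eq_square power3_eq_cube)
  from frechet_derivative_at[OF this, THEN fun_cong, of u]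
  have "frechet_derivative (\<lambda>q. half_space_metric \<epsilon> q v w) (at y) u
      = - 2 * flat_form \<epsilon> v w * snd u * inverse (snd y) ^ 3" by (rule sym)
  also have "\<dots> = half_space_metric \<epsilon> y (half_space_christoffel \<epsilon> y u v) w
      + half_space_metric \<epsilon> y v (half_space_christoffel \<epsilon> y u w)"
    using y by (simp add: half_space_metric_def half_space_christoffel_def flat_form_simps
        flat_form_vertical[OF e] flat_form_sym[of \<epsilon> v u] field_simps power2_eq_square power3_eq_cube
        del: scaleR_Pair)
  finally show "frechet_derivative (\<lambda>q. half_space_metric \<epsilon> q v w) (at y) u
      = half_space_metric \<epsilon> y (half_space_christoffel \<epsilon> y u v) w
      + half_space_metric \<epsilon> y v (half_space_christoffel \<epsilon> y u w)" .
qed (rule bilinear_half_space_christoffel, rule half_space_christoffel_sym)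

section \<open>Self-adjoint operators\<close>

text \<open>\<open>g\<close> is unrelated to the inner product of the type: it will be the first
  form at a point, read in coordinates, and \<open>S\<close> the shape operator. The norm of the
  type serves topological purposes only.\<close>

locale self_adjoint =
  fixes g :: "'v::euclidean_space \<Rightarrow> 'v \<Rightarrow> real" and S :: "'v \<Rightarrow> 'v"
  assumes bil: "bilinear g" and sym: "g a b = g b a" and pos: "a \<noteq> 0 \<Longrightarrow> g a a > 0"
    and lin: "linear S" and adj: "g (S a) b = g a (S b)"
begin

definition eigenvalues :: "real set" where
  "eigenvalues = {\<kappa>. \<exists>u. u \<noteq> 0 \<and> S u = \<kappa> *\<^sub>R u}"

lemmas g_simps =
  bilinear_ladd[OF bil] bilinear_radd[OF bil] bilinear_lsub[OF bil] bilinear_rsub[OF bil]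
  bilinear_lmul[OF bil] bilinear_rmul[OF bil] bilinear_lneg[OF bil] bilinear_rneg[OF bil]
  bilinear_lzero[OF bil] bilinear_rzero[OF bil]

lemmas S_simps = linear_add[OF lin] linear_diff[OF lin] linear_cmul[OF lin] linear_0[OF lin]

lemma nondeg: "(\<And>b. g a b = 0) \<Longrightarrow> a = 0"
  using pos[of a] by (metis less_irrefl)

lemma orthogonal_eigenvectors:
  assumes "S u = \<kappa> *\<^sub>R u" "S v = \<mu> *\<^sub>R v" "\<kappa> \<noteq> \<mu>"
  shows "g u v = 0"
  using adj[of u v] assms by (simp add: g_simps)

text \<open>A maximiser of the Rayleigh quotient on \<open>W\<close> is an eigenvector.\<close>

lemma invariant_subspace_eigenvector:
  assumes W: "subspace W" "\<And>w. w \<in> W \<Longrightarrow> S w \<in> W" and w0: "w0 \<in> W" "w0 \<noteq> 0"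
  obtains \<kappa> u where "u \<in> W" "u \<noteq> 0" "S u = \<kappa> *\<^sub>R u"
proof -
  \<comment> \<open>The quotient is invariant under scaling, so it may be maximised on the sphere of
    the norm of the type, where compactness is at hand, instead of the unit sphere of
    \<open>g\<close>.\<close>
  let ?K = "sphere 0 1 \<inter> W"
  let ?f = "\<lambda>u. g (S u) u / g u u"
  have g: "bounded_bilinear g" using bil bilinear_conv_bounded_bilinear by blast
  have "compact ?K"
    by (intro compact_Int_closed compact_sphere closed_subspace W)
  moreover have "inverse (norm w0) *\<^sub>R w0 \<in> ?K"
    using w0 W(1) by (simp add: subspace_scale)
  moreover have "continuous_on ?K ?f"
  proof (intro continuous_intros bounded_bilinear.continuous_on[OF g]
      linear_continuous_on linear_conv_bounded_linear[THEN iffD1] lin ballI)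
    fix u assume "u \<in> ?K"
    then have "u \<noteq> 0" by auto
    then show "g u u \<noteq> 0" using pos[of u] by simp
  qed
  ultimately obtain u where u: "u \<in> ?K" "\<And>w. w \<in> ?K \<Longrightarrow> ?f w \<le> ?f u"
    using continuous_attains_sup[of ?K ?f] by blast
  define \<kappa> where "\<kappa> = ?f u"
  have un: "u \<noteq> 0" "u \<in> W" using u(1) by auto
  define Q where "Q a b = \<kappa> * g a b - g (S a) b" for a b
  have Qsym: "Q a b = Q b a" for a b
    using adj[of a b] sym[of a b] sym[of a "S b"] by (simp add: Q_def)
  have Qpos: "Q w w \<ge> 0" if "w \<in> W" for w
  proof (cases "w = 0")
    case False
    have "?f (inverse (norm w) *\<^sub>R w) \<le> \<kappa>"
      unfolding \<kappa>_def using that False W(1) by (intro u(2)) (simp add: subspace_scale)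
    also have "?f (inverse (norm w) *\<^sub>R w) = ?f w"
      using False by (simp add: S_simps g_simps)
    finally show ?thesis
      using pos[OF False] by (simp add: Q_def divide_le_eq)
  qed (simp add: Q_def g_simps)
  have Qu: "Q u u = 0"
    using pos[OF un(1)] by (simp add: Q_def \<kappa>_def)
  \<comment> \<open>By maximality \<open>Q\<close> is positive semidefinite on \<open>W\<close>, and
    it vanishes at \<open>u\<close>; a nonzero cross term would make it negative somewhere on the
    line through \<open>u\<close> in direction \<open>w\<close>.\<close>
  have Q0: "Q u w = 0" if w: "w \<in> W" for w
  proof (rule ccontr)
    assume ne: "Q u w \<noteq> 0"
    have exp: "Q (u + t *\<^sub>R w) (u + t *\<^sub>R w) = t * (2 * Q u w + t * Q w w)" for t
    proof -
      have "Q (u + t *\<^sub>R w) (u + t *\<^sub>R w) = Q u u + t * Q u w + t * Q w u + t * t * Q w w"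
        by (simp add: Q_def S_simps g_simps algebra_simps)
      then show ?thesis using Qu Qsym[of w u] by (simp add: algebra_simps)
    qed
    \<comment> \<open>The minimum would be attained with denominator \<open>Q w w\<close>; adding 1
      keeps the denominator positive when \<open>Q w w\<close> vanishes, and the value of the
      quadratic stays negative.\<close>
    define t where "t = - Q u w / (Q w w + 1)"
    have D: "Q w w + 1 > 0" using Qpos[OF w] by simp
    have "2 * Q u w + t * Q w w = Q u w * (Q w w + 2) / (Q w w + 1)"
      using D by (simp add: t_def field_simps)
    then have "t * (2 * Q u w + t * Q w w) = - (Q u w)\<^sup>2 * (Q w w + 2) / (Q w w + 1)\<^sup>2"
      by (simp add: t_def power2_eq_square)
    also have "\<dots> < 0"
      using D ne by (simp add: divide_less_0_iff mult_less_0_iff zero_less_mult_iff)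
    finally have "Q (u + t *\<^sub>R w) (u + t *\<^sub>R w) < 0" using exp by simp
    moreover have "u + t *\<^sub>R w \<in> W" using un w W(1) by (simp add: subspace_add subspace_scale)
    ultimately show False using Qpos by fastforce
  qed
  define d where "d = \<kappa> *\<^sub>R u - S u"
  have "d \<in> W" using un W by (simp add: d_def subspace_diff subspace_scale)
  moreover have "g d b = Q u b" for b by (simp add: Q_def g_simps d_def)
  ultimately have "g d d = 0" using Q0 by simp
  then have "d = 0" using pos[of d] by (metis less_irrefl)
  then have "S u = \<kappa> *\<^sub>R u" by (simp add: d_def)
  then show thesis using that un by blast
qed

text \<open>The range of \<open>P = (S - \<kappa>)(S - \<mu>)\<close> is invariant, but an eigenvector \<open>P b\<close> in it would satisfy
  \<open>g (P b) (P b) = g b (P (P b)) = 0\<close>.\<close>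

lemma minimal_polynomial_of_two_eigenvalues:
  assumes "eigenvalues = {\<kappa>, \<mu>}"
  shows "S (S a) = (\<kappa> + \<mu>) *\<^sub>R S a - (\<kappa> * \<mu>) *\<^sub>R a"
proof -
  define P where "P a = S (S a) - (\<kappa> + \<mu>) *\<^sub>R S a + (\<kappa> * \<mu>) *\<^sub>R a" for a
  have linP: "linear P"
    unfolding P_def linear_iff by (auto simp: S_simps algebra_simps)
  have SP: "S (P a) = P (S a)" for a
    by (simp add: P_def S_simps)
  have Padj: "g (P a) b = g a (P b)" for a b
    unfolding P_def by (simp add: g_simps adj)
  have "P a = 0"
  proof (rule ccontr)
    assume ne: "P a \<noteq> 0"
    obtain \<nu> u where u: "u \<in> range P" "u \<noteq> 0" "S u = \<nu> *\<^sub>R u"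
    proof (rule invariant_subspace_eigenvector)
      show "subspace (range P)" using linP subspace_UNIV by (rule linear_subspace_image)
      show "S w \<in> range P" if "w \<in> range P" for w using that SP by auto
      show "P a \<in> range P" by simp
    qed (use ne in auto)
    have "\<nu> = \<kappa> \<or> \<nu> = \<mu>" using u assms unfolding eigenvalues_def by blast
    then have "P u = 0" using u(3) by (auto simp: P_def S_simps algebra_simps)
    moreover obtain b where "u = P b" using u(1) by blast
    ultimately have "g u u = 0" using Padj[of b u] by (simp add: g_simps)
    then show False using pos[OF u(2)] by simp
  qed
  then show ?thesis by (simp add: P_def algebra_simps)
qed

text \<open>Completing the square gives (S - b/2)^2 = d with d a quarter of the discriminant. As S -
  b/2 is self-adjoint and nonzero, comparing the lengths of a vector and its image forces d > 0, so
  there are two distinct real roots.\<close>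

lemma two_eigenvalues_of_quadratic:
  assumes quad: "\<And>a. S (S a) = b *\<^sub>R S a - c *\<^sub>R a"
    and nonscalar: "\<And>\<kappa>. \<exists>a. S a \<noteq> \<kappa> *\<^sub>R a"
  obtains \<kappa> \<mu> where "\<kappa> \<noteq> \<mu>" "eigenvalues = {\<kappa>, \<mu>}" "\<kappa> * \<mu> = c"
proof -
  define d where "d = b\<^sup>2 / 4 - c"
  obtain a where a: "S a \<noteq> (b / 2) *\<^sub>R a" using nonscalar by blast
  define y where "y = S a - (b / 2) *\<^sub>R a"
  have "y \<noteq> 0" "a \<noteq> 0" using a by (auto simp: y_def S_simps)
  have "g y y = g (S a - (b / 2) *\<^sub>R a) y" by (simp only: y_def)
  also have "\<dots> = g a (S y - (b / 2) *\<^sub>R y)" by (simp add: g_simps adj)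
  also have "S y - (b / 2) *\<^sub>R y = d *\<^sub>R a"
  proof -
    have "b *\<^sub>R S a = (b / 2) *\<^sub>R S a + (b / 2) *\<^sub>R S a" by (simp flip: scaleR_add_left)
    then show ?thesis
      by (simp add: y_def d_def S_simps quad algebra_simps power2_eq_square)
  qed
  finally have "g y y = d * g a a" by (simp add: g_simps)
  then have d: "d > 0"
    using pos[OF \<open>y \<noteq> 0\<close>] pos[OF \<open>a \<noteq> 0\<close>] by (simp add: zero_less_mult_iff)
  define \<kappa> where "\<kappa> = b / 2 + sqrt d"
  define \<mu> where "\<mu> = b / 2 - sqrt d"
  have km: "\<kappa> + \<mu> = b" "\<kappa> * \<mu> = c" "\<kappa> \<noteq> \<mu>"
  proof -
    have "\<kappa> * \<mu> = b\<^sup>2 / 4 - (sqrt d)\<^sup>2"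
      by (simp add: \<kappa>_def \<mu>_def algebra_simps power2_eq_square)
    then show "\<kappa> * \<mu> = c" using d by (simp add: d_def)
  qed (use d in \<open>simp_all add: \<kappa>_def \<mu>_def\<close>)
  \<comment> \<open>Since (S - x)(S - z) = 0, every nonzero vector in the image of S - z is an
    eigenvector for x, and such a vector exists because S is not scalar.\<close>
  have mem: "x \<in> eigenvalues" if "x + z = b" "x * z = c" for x z
  proof -
    obtain v where v: "S v \<noteq> z *\<^sub>R v" using nonscalar by blast
    have "S (S v - z *\<^sub>R v) = x *\<^sub>R (S v - z *\<^sub>R v)"
      by (simp add: S_simps quad that(1)[symmetric] that(2)[symmetric] algebra_simps)
    then show ?thesis using v unfolding eigenvalues_def by (intro CollectI exI[of _ "S v - z *\<^sub>R v"]) simp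
  qed
  have "x = \<kappa> \<or> x = \<mu>" if "x \<in> eigenvalues" for x
  proof -
    from that obtain u where u: "u \<noteq> 0" "S u = x *\<^sub>R u" unfolding eigenvalues_def by blast
    have "(x * x - b * x + c) *\<^sub>R u = 0"
      using quad[of u] u by (simp add: S_simps algebra_simps)
    then have "x * x - b * x + c = 0" using u by simp
    then have "(x - \<kappa>) * (x - \<mu>) = 0"
      by (simp add: km(1)[symmetric] km(2)[symmetric] algebra_simps)
    then show ?thesis by simp
  qed
  moreover have "\<kappa> \<in> eigenvalues" "\<mu> \<in> eigenvalues"
    using mem[of \<kappa> \<mu>] mem[of \<mu> \<kappa>] km by (simp_all add: ac_simps)
  ultimately have "eigenvalues = {\<kappa>, \<mu>}" by blast
  then show thesis using that km by blast
qed

text \<open>\<rho> enters only the coefficient of S in the quadratic equation, not its constant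
  term. Proportionality thus fixes the product of the two eigenvalues and leaves their sum free, to
  be absorbed by \<rho>.\<close>

lemma square_proportional_iff:
  fixes \<epsilon> \<eta> :: real
  assumes e: "\<epsilon>\<^sup>2 = 1" and nonscalar: "\<And>\<kappa>. \<exists>a. S a \<noteq> \<kappa> *\<^sub>R a"
  shows "(\<exists>\<rho>. \<forall>a b. g (\<eta> *\<^sub>R a - \<epsilon> *\<^sub>R S a) (\<eta> *\<^sub>R b - \<epsilon> *\<^sub>R S b) = \<rho> * g (S a) b) \<longleftrightarrow>
    card eigenvalues = 2 \<and> (\<forall>\<kappa>\<in>eigenvalues. \<forall>\<mu>\<in>eigenvalues. \<kappa> \<noteq> \<mu> \<longrightarrow> \<kappa> * \<mu> = \<eta>\<^sup>2)"
    (is "?L \<longleftrightarrow> ?R")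
proof -
  have sq: "g (\<eta> *\<^sub>R a - \<epsilon> *\<^sub>R S a) (\<eta> *\<^sub>R b - \<epsilon> *\<^sub>R S b)
      = g (\<eta>\<^sup>2 *\<^sub>R a - (2 * \<epsilon> * \<eta>) *\<^sub>R S a + S (S a)) b" for a b
  proof -
    have "g (\<eta> *\<^sub>R a - \<epsilon> *\<^sub>R S a) (\<eta> *\<^sub>R b - \<epsilon> *\<^sub>R S b)
        = \<eta>\<^sup>2 * g a b - 2 * \<epsilon> * \<eta> * g (S a) b + \<epsilon>\<^sup>2 * g (S a) (S b)"
      by (simp add: g_simps adj power2_eq_square algebra_simps)
    then show ?thesis using e by (simp add: g_simps adj)
  qed
  show ?thesis
  proof
    assume ?L
    then obtain \<rho> where \<rho>: "\<And>a b. g (\<eta>\<^sup>2 *\<^sub>R a - (2 * \<epsilon> * \<eta>) *\<^sub>R S a + S (S a)) b = \<rho> * g (S a) b"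
      using sq by metis
    have "S (S a) = (\<rho> + 2 * \<epsilon> * \<eta>) *\<^sub>R S a - \<eta>\<^sup>2 *\<^sub>R a" for a
    proof -
      have "g (\<eta>\<^sup>2 *\<^sub>R a - (2 * \<epsilon> * \<eta>) *\<^sub>R S a + S (S a) - \<rho> *\<^sub>R S a) b = 0" for b
        using \<rho>[of a b] by (simp add: g_simps)
      from nondeg[OF this] show ?thesis by (simp add: algebra_simps)
    qed
    from two_eigenvalues_of_quadratic[OF this nonscalar]
    obtain \<kappa> \<mu> where "\<kappa> \<noteq> \<mu>" "eigenvalues = {\<kappa>, \<mu>}" "\<kappa> * \<mu> = \<eta>\<^sup>2" by blast
    then show ?R by (auto simp: mult.commute)
  next
    assume R: ?R
    then obtain \<kappa> \<mu> where km: "eigenvalues = {\<kappa>, \<mu>}" "\<kappa> \<noteq> \<mu>" by (metis card_2_iff)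
    then have prod: "\<kappa> * \<mu> = \<eta>\<^sup>2" using R by blast
    \<comment> \<open>The factor is found by comparing the coefficients of S, that is, the sums of
      the roots.\<close>
    show ?L
      unfolding sq minimal_polynomial_of_two_eigenvalues[OF km(1)] prod
      by (rule exI[of _ "\<kappa> + \<mu> - 2 * \<epsilon> * \<eta>"]) (simp add: g_simps algebra_simps)
  qed
qed

end

section \<open>The Gauss equation in a coordinate patch\<close>

lemma axis_expansion: "(t :: real^'n) = (\<Sum>i\<in>UNIV. t $ i *\<^sub>R axis i 1)"
  by (simp add: basis_expansion flip: scalar_mult_eq_scaleR)

lemma linear_axis_expansion:
  fixes f :: "real^'n \<Rightarrow> 'b::real_vector"
  assumes "linear f"
  shows "f t = (\<Sum>i\<in>UNIV. t $ i *\<^sub>R f (axis i 1))"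
  by (subst axis_expansion[of t]) (simp add: linear_sum[OF assms] linear_cmul[OF assms])

text \<open>The hypersurface seen in a single chart. Orthogonality and positivity are stated for the
  flat form, of which the half-space metric is a positive multiple at each point; positivity also
  contains the injectivity of the differential.\<close>

locale hypersurface_patch =
  fixes \<epsilon> :: real and U :: "(real^'n::finite) set" and X \<nu> :: "real^'n \<Rightarrow> 'n ambient"
  assumes eps: "\<epsilon> = 1 \<or> \<epsilon> = - 1"
    and open_U: "open U"
    and smooth_X: "smooth_on U X" and smooth_\<nu>: "smooth_on U \<nu>"
    and height_pos: "q \<in> U \<Longrightarrow> snd (X q) > 0"
    and unit: "q \<in> U \<Longrightarrow> flat_form \<epsilon> (\<nu> q) (\<nu> q) = \<epsilon>"
    and normal: "q \<in> U \<Longrightarrow> flat_form \<epsilon> (\<nu> q) (pd X u q) = 0"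
    and spacelike: "q \<in> U \<Longrightarrow> u \<noteq> 0 \<Longrightarrow> flat_form \<epsilon> (pd X u q) (pd X u q) > 0"
begin

abbreviation F :: "'n ambient \<Rightarrow> 'n ambient \<Rightarrow> real" where "F \<equiv> flat_form \<epsilon>"

lemma eps2: "\<epsilon>\<^sup>2 = 1" "\<epsilon> * \<epsilon> = 1" "\<epsilon> * (\<epsilon> * c) = c" "\<epsilon> \<noteq> 0"
  using eps by auto

lemma normal': "q \<in> U \<Longrightarrow> F (pd X u q) (\<nu> q) = 0"
  using normal flat_form_sym by metis

lemma X_deriv: "q \<in> U \<Longrightarrow> (X has_derivative (\<lambda>v. pd X v q)) (at q)"
  and X_deriv2: "q \<in> U \<Longrightarrow> (pd X v has_derivative (\<lambda>u. pd (pd X v) u q)) (at q)"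
  and X_deriv3: "q \<in> U \<Longrightarrow> (pd (pd X w) v has_derivative (\<lambda>u. pd (pd (pd X w) v) u q)) (at q)"
  and \<nu>_deriv: "q \<in> U \<Longrightarrow> (\<nu> has_derivative (\<lambda>v. pd \<nu> v q)) (at q)"
  by - (rule smooth_on_has_derivative[of U], intro smooth_on_pd smooth_X smooth_\<nu>, assumption)+

lemma X_deriv2_sym: "q \<in> U \<Longrightarrow> pd (pd X v) u q = pd (pd X u) v q"
  and X_deriv3_sym: "q \<in> U \<Longrightarrow> pd (pd (pd X w) v) u q = pd (pd (pd X w) u) v q"
  by - (rule second_derivative_symmetric[OF _ open_U], intro smooth_on_pd smooth_X, assumption)+

lemma linear_X: "q \<in> U \<Longrightarrow> linear (\<lambda>v. pd X v q)"
  and linear_\<nu>: "q \<in> U \<Longrightarrow> linear (\<lambda>v. pd \<nu> v q)"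
  and linear_X2: "q \<in> U \<Longrightarrow> linear (\<lambda>u. pd (pd X v) u q)"
  using X_deriv \<nu>_deriv X_deriv2 has_derivative_linear by blast+

lemma linear_X2': "q \<in> U \<Longrightarrow> linear (\<lambda>v. pd (pd X v) u q)"
proof -
  assume q: "q \<in> U"
  then have "(\<lambda>v. pd (pd X v) u q) = (\<lambda>v. pd (pd X u) v q)"
    by (intro ext X_deriv2_sym)
  then show ?thesis using linear_X2[OF q] by simp
qed

lemma X_inj: "q \<in> U \<Longrightarrow> pd X u q = 0 \<Longrightarrow> u = 0"
  using spacelike[of q u] by (auto simp: flat_form_simps)

section \<open>Tangential projection\<close>

lemma frame:
  assumes q: "q \<in> U"
  shows "\<exists>t. a = pd X t q + (\<epsilon> * F a (\<nu> q)) *\<^sub>R \<nu> q"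
proof -
  \<comment> \<open>Domain and target have the same dimension n+1, so injectivity of this linear map
    already shows that tangent vectors and the normal span everything.\<close>
  define L where "L p = pd X (fst p) q + snd p *\<^sub>R \<nu> q" for p :: "'n ambient"
  have L: "linear L"
    unfolding L_def linear_iff
    by (auto simp: linear_add[OF linear_X[OF q]] linear_cmul[OF linear_X[OF q]] algebra_simps)
  have normal_part: "F (L p) (\<nu> q) = snd p * \<epsilon>" for p
    by (simp add: L_def flat_form_simps normal' unit q)
  have "inj L"
  proof (subst linear_injective_0[OF L], intro allI impI)
    fix p assume p: "L p = 0"
    then have "snd p = 0" using normal_part[of p] eps2 by (simp add: flat_form_simps)
    moreover from this have "fst p = 0" using X_inj[OF q] p by (simp add: L_def)
    ultimately show "p = 0" by (simp add: prod_eq_iff)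
  qed
  then obtain p where "a = L p"
    using linear_injective_imp_surjective[OF L] by (metis surjD)
  moreover from this have "\<epsilon> * F a (\<nu> q) = snd p" using normal_part[of p] eps2 by (simp add: mult.commute)
  ultimately show ?thesis by (auto simp: L_def)
qed

text \<open>The tangential part of an ambient vector, pulled back to chart coordinates through the
  injective differential of \<open>X\<close>; on \<open>U\<close> the choice is therefore
  unique.\<close>

definition tang :: "real^'n \<Rightarrow> 'n ambient \<Rightarrow> real^'n" where
  "tang q a = (SOME t. a = pd X t q + (\<epsilon> * F a (\<nu> q)) *\<^sub>R \<nu> q)"

lemma tang: "q \<in> U \<Longrightarrow> a = pd X (tang q a) q + (\<epsilon> * F a (\<nu> q)) *\<^sub>R \<nu> q"
  unfolding tang_def by (rule someI_ex) (rule frame)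

lemma F_tang: "q \<in> U \<Longrightarrow> F (pd X (tang q a) q) (pd X z q) = F a (pd X z q)"
  by (subst (2) tang[of q a]) (simp_all add: flat_form_simps normal)

lemma tang_eqI:
  assumes q: "q \<in> U" and "\<And>z. F a (pd X z q) = F (pd X t q) (pd X z q)"
  shows "tang q a = t"
proof (rule ccontr)
  let ?d = "tang q a - t"
  assume "tang q a \<noteq> t"
  then have "F (pd X ?d q) (pd X ?d q) > 0" using spacelike[OF q] by simp
  moreover have "F (pd X ?d q) (pd X z q) = 0" for z
    using assms(2)[of z] F_tang[OF q, of a z]
    by (simp add: linear_diff[OF linear_X[OF q]] flat_form_simps)
  ultimately show False by simp
qed

lemma linear_tang: "q \<in> U \<Longrightarrow> linear (tang q)"
  by (rule linearI; rule tang_eqI)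
    (simp_all add: flat_form_simps F_tang linear_add[OF linear_X] linear_cmul[OF linear_X])

text \<open>The coordinates of the tangential part solve the normal equations, whose matrix is the
  Gram matrix of the coordinate frame; it is invertible because the flat form is positive on tangent
  vectors.\<close>

lemma differentiable_tang:
  assumes q: "q \<in> U" and a: "a differentiable (at q)"
  shows "(\<lambda>p. tang p (a p)) differentiable (at q)"
proof (rule differentiable_linear_solution[OF open_U q])
  let ?M = "\<lambda>p. \<chi> i j. F (pd X (axis i 1) p) (pd X (axis j 1) p)"
  let ?b = "\<lambda>p. \<chi> i. F (pd X (axis i 1) p) (a p)"
  have bd: "bounded_linear (F c)" "bounded_linear (\<lambda>c. F c d)" for c d
    using bounded_bilinear_flat_form
    by (auto intro: bounded_bilinear.bounded_linear_right bounded_bilinear.bounded_linear_left)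
  have Mv: "?M p *v t = (\<chi> i. F (pd X (axis i 1) p) (pd X t p))" if "p \<in> U" for p t
    by (subst linear_axis_expansion[OF linear_X[OF that], of t])
      (simp add: vec_eq_iff matrix_vector_mult_def bounded_linear.linear[OF bd(1), THEN linear_sum]
        flat_form_simps mult.commute)
  show "?M p *v tang p (a p) = ?b p" if "p \<in> U" for p
  proof -
    have "F (pd X (axis i 1) p) (pd X (tang p (a p)) p) = F (pd X (axis i 1) p) (a p)" for i
      using F_tang[OF that, of "a p" "axis i 1"] flat_form_sym[of \<epsilon> "pd X (axis i 1) p" "a p"]
        flat_form_sym[of \<epsilon> "pd X (axis i 1) p" "pd X (tang p (a p)) p"] by simp
    then show ?thesis unfolding Mv[OF that] by (simp add: vec_eq_iff)
  qed
  show "det (?M p) \<noteq> 0" if p: "p \<in> U" for p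
  proof -
    have "t = 0" if "?M p *v t = 0" for t
    proof (rule ccontr)
      assume "t \<noteq> 0"
      have "F (pd X t p) (pd X t p) = (\<Sum>i\<in>UNIV. t $ i * F (pd X (axis i 1) p) (pd X t p))"
        by (subst linear_axis_expansion[OF linear_X[OF p], of t])
          (simp add: bounded_linear.linear[OF bd(2), THEN linear_sum] flat_form_simps)
      also have "\<dots> = 0" using that Mv[OF p, of t] by (simp add: vec_eq_iff)
      finally show False using spacelike[OF p \<open>t \<noteq> 0\<close>] by simp
    qed
    then show ?thesis
      using matrix_left_invertible_ker[of "?M p"] invertible_left_inverse invertible_det_nz by blast
  qed
  have Fdiff: "(\<lambda>p. F (f p) (g p)) differentiable (at q)"
    if "f differentiable (at q)" "g differentiable (at q)" for f g :: "real^'n \<Rightarrow> 'n ambient"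
    using bounded_bilinear.FDERIV[OF bounded_bilinear_flat_form] that unfolding differentiable_def by blast
  have "pd X v differentiable (at q)" for v
    using X_deriv2[OF q] differentiableI by blast
  then show "(\<lambda>p. ?M p $ i $ j) differentiable (at q)" "(\<lambda>p. ?b p $ i) differentiable (at q)" for i j
    using a by (simp_all add: Fdiff)
qed

section \<open>The induced connection\<close>

definition covX :: "real^'n \<Rightarrow> real^'n \<Rightarrow> real^'n \<Rightarrow> 'n ambient" where
  "covX q u v = pd (pd X v) u q + half_space_christoffel \<epsilon> (X q) (pd X u q) (pd X v q)"

text \<open>The tangential part of the ambient derivative of a coordinate field along
  \<open>X\<close>: the candidate for the Christoffel form of the first form.\<close>

definition \<Gamma> :: "real^'n \<Rightarrow> real^'n \<Rightarrow> real^'n \<Rightarrow> real^'n" where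
  "\<Gamma> q u v = tang q (covX q u v)"

lemma cov_deriv_half_space:
  "q \<in> U \<Longrightarrow> cov_deriv (half_space_metric \<epsilon>) X (\<lambda>p. pd X v p) q u = covX q u v"
  by (simp add: cov_deriv_def covX_def christoffel_half_space[OF eps2(1) height_pos])

lemma covX_sym: "q \<in> U \<Longrightarrow> covX q u v = covX q v u"
  by (simp add: covX_def X_deriv2_sym[of q v u] half_space_christoffel_sym[of _ _ "pd X u q"])

lemma \<Gamma>_sym: "q \<in> U \<Longrightarrow> \<Gamma> q u v = \<Gamma> q v u"
  by (simp add: \<Gamma>_def covX_sym[of q u])

lemma linear_covX:
  assumes q: "q \<in> U" shows "linear (\<lambda>u. covX q u v)"
  unfolding linear_iff covX_def
  by (simp add: bilinear_ladd[OF bilinear_half_space_christoffel]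
      bilinear_lmul[OF bilinear_half_space_christoffel] linear_add[OF linear_X[OF q]] linear_cmul[OF linear_X[OF q]]
      linear_add[OF linear_X2[OF q]] linear_cmul[OF linear_X2[OF q]] algebra_simps)

lemma bilinear_\<Gamma>: "q \<in> U \<Longrightarrow> bilinear (\<Gamma> q)"
proof -
  assume q: "q \<in> U"
  have "linear (\<lambda>u. \<Gamma> q u v)" for v
    using linear_compose[OF linear_covX[OF q] linear_tang[OF q]] by (simp add: \<Gamma>_def[abs_def] o_def)
  moreover from this have "linear (\<lambda>v. \<Gamma> q u v)" for u by (simp add: \<Gamma>_sym[OF q, of u])
  ultimately show ?thesis by (simp add: bilinear_def)
qed

lemma first_form_eq: "first_form \<epsilon> X q u v = F (pd X u q) (pd X v q) / (snd (X q))\<^sup>2"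
  by (simp add: first_form_def half_space_metric_def)

lemma first_form_sym: "first_form \<epsilon> X q u v = first_form \<epsilon> X q v u"
  by (simp add: first_form_eq flat_form_sym)

lemma bilinear_first_form: "q \<in> U \<Longrightarrow> bilinear (first_form \<epsilon> X q)"
  unfolding bilinear_def linear_iff first_form_eq
  by (auto simp: linear_add[OF linear_X] linear_cmul[OF linear_X] flat_form_simps add_divide_distrib)

lemma first_form_pos: "q \<in> U \<Longrightarrow> u \<noteq> 0 \<Longrightarrow> first_form \<epsilon> X q u u > 0"
  using spacelike[of q u] height_pos[of q] by (simp add: first_form_eq)

lemma first_form_\<Gamma>: "q \<in> U \<Longrightarrow>
    first_form \<epsilon> X q (\<Gamma> q u v) w = F (covX q u v) (pd X w q) / (snd (X q))\<^sup>2"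
  by (simp add: first_form_eq \<Gamma>_def F_tang)

text \<open>Symmetry and metric compatibility pass from the ambient connection to its tangential
  part, since pairing with a tangent vector does not see the normal part.\<close>

lemma christoffel_first_form:
  assumes q: "q \<in> U"
  shows "christoffel (first_form \<epsilon> X) q = \<Gamma> q"
proof (rule christoffel_eqI)
  show "a = 0" if "\<And>b. first_form \<epsilon> X q a b = 0" for a
    using first_form_pos[OF q, of a] that[of a] by fastforce
  fix u v w
  have "((\<lambda>p. first_form \<epsilon> X p v w) has_derivative
      (\<lambda>u. (F (pd X v q) (pd (pd X w) u q) + F (pd (pd X v) u q) (pd X w q)) / (snd (X q))\<^sup>2
        - 2 * F (pd X v q) (pd X w q) * snd (pd X u q) * inverse (snd (X q)) ^ 3)) (at q)"
    unfolding first_form_eq using height_pos[OF q]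
    by (auto intro!: derivative_eq_intros bounded_bilinear.FDERIV[OF bounded_bilinear_flat_form]
        X_deriv2[OF q] X_deriv[OF q] simp: field_simps power2_eq_square power3_eq_cube)
  from frechet_derivative_at[OF this, THEN fun_cong, of u]
  have "frechet_derivative (\<lambda>p. first_form \<epsilon> X p v w) (at q) u =
      (F (pd X v q) (pd (pd X w) u q) + F (pd (pd X v) u q) (pd X w q)) / (snd (X q))\<^sup>2
        - 2 * F (pd X v q) (pd X w q) * snd (pd X u q) * inverse (snd (X q)) ^ 3" by (rule sym)
  also have "\<dots> = first_form \<epsilon> X q (\<Gamma> q u v) w + first_form \<epsilon> X q (\<Gamma> q u w) v"
    unfolding first_form_\<Gamma>[OF q] covX_def half_space_christoffel_def using height_pos[OF q]
    by (simp add: flat_form_simps flat_form_vertical[OF eps2(1)] flat_form_sym[of \<epsilon> "pd X w q" "pd X v q"]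
        flat_form_sym[of \<epsilon> "pd X v q" "pd (pd X w) u q"]
        field_simps power2_eq_square power3_eq_cube del: scaleR_Pair)
  finally show "frechet_derivative (\<lambda>p. first_form \<epsilon> X p v w) (at q) u =
      first_form \<epsilon> X q (\<Gamma> q u v) w + first_form \<epsilon> X q v (\<Gamma> q u w)"
    by (simp only: first_form_sym[of q v])
qed (use bilinear_first_form[OF q] first_form_sym bilinear_\<Gamma>[OF q] \<Gamma>_sym[OF q] in blast)+

lemma cov_deriv_first_form:
  "q \<in> U \<Longrightarrow> cov_deriv (first_form \<epsilon> X) id Y q u = pd Y u q + \<Gamma> q u (Y q)"
  by (simp add: cov_deriv_def christoffel_first_form)

section \<open>Weingarten relations and the shape operator\<close>

lemma \<nu>_tangent:
  assumes q: "q \<in> U" shows "F (pd \<nu> u q) (\<nu> q) = 0"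
proof -
  have "((\<lambda>p. F (\<nu> p) (\<nu> p)) has_derivative (\<lambda>u. F (\<nu> q) (pd \<nu> u q) + F (pd \<nu> u q) (\<nu> q))) (at q)"
    by (intro bounded_bilinear.FDERIV[OF bounded_bilinear_flat_form] \<nu>_deriv q)
  moreover have "((\<lambda>p. F (\<nu> p) (\<nu> p)) has_derivative (\<lambda>u. 0)) (at q)"
    by (rule has_derivative_transform_within_open[OF has_derivative_const open_U q]) (simp add: unit)
  ultimately show ?thesis
    using has_derivative_unique flat_form_sym[of \<epsilon> "\<nu> q"] by (fastforce dest: fun_cong)
qed

lemma X_deriv2_normal:
  assumes q: "q \<in> U" shows "F (pd (pd X v) u q) (\<nu> q) = - F (pd \<nu> u q) (pd X v q)"
proof -
  have "((\<lambda>p. F (\<nu> p) (pd X v p)) has_derivative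
      (\<lambda>u. F (\<nu> q) (pd (pd X v) u q) + F (pd \<nu> u q) (pd X v q))) (at q)"
    by (intro bounded_bilinear.FDERIV[OF bounded_bilinear_flat_form] \<nu>_deriv X_deriv2 q)
  moreover have "((\<lambda>p. F (\<nu> p) (pd X v p)) has_derivative (\<lambda>u. 0)) (at q)"
    by (rule has_derivative_transform_within_open[OF has_derivative_const open_U q]) (simp add: normal)
  ultimately have "(\<lambda>u. F (\<nu> q) (pd (pd X v) u q) + F (pd \<nu> u q) (pd X v q)) = (\<lambda>u. 0)"
    by (rule has_derivative_unique)
  from fun_cong[OF this, of u] show ?thesis by (simp add: flat_form_sym[of \<epsilon> "\<nu> q"])
qed

lemma second_form_covX:
  assumes q: "q \<in> U"
  shows "second_form \<epsilon> X \<nu> q u v = \<epsilon> * F (covX q u v) (\<nu> q) / snd (X q)"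
  unfolding second_form_def cov_deriv_half_space[OF q] cov_deriv_first_form[OF q]
proof (rule the_equality)
  have "covX q u v = pd X (\<Gamma> q u v) q + (\<epsilon> * F (covX q u v) (\<nu> q)) *\<^sub>R \<nu> q"
    unfolding \<Gamma>_def by (rule tang[OF q])
  then show "covX q u v = pd X (pd (\<lambda>_. v) u q + \<Gamma> q u v) q
      + (\<epsilon> * F (covX q u v) (\<nu> q) / snd (X q)) *\<^sub>R snd (X q) *\<^sub>R \<nu> q"
    using height_pos[OF q] by simp
next
  fix h assume "covX q u v = pd X (pd (\<lambda>_. v) u q + \<Gamma> q u v) q + h *\<^sub>R snd (X q) *\<^sub>R \<nu> q"
  then have "F (covX q u v) (\<nu> q) = h * snd (X q) * \<epsilon>"
    by (simp add: flat_form_simps normal'[OF q] unit[OF q])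
  then show "h = \<epsilon> * F (covX q u v) (\<nu> q) / snd (X q)"
    using height_pos[OF q] eps2 by (simp add: field_simps)
qed

text \<open>Of the half-space Christoffel form, only the vertical term has a normal component; it
  gives the multiple of the first form. The rest is the flat second fundamental form, rewritten by
  differentiating the orthogonality of \<nu> and the tangent space.\<close>

lemma second_form_eq:
  assumes q: "q \<in> U"
  shows "second_form \<epsilon> X \<nu> q u v =
    \<epsilon> * snd (\<nu> q) * first_form \<epsilon> X q u v - \<epsilon> * F (pd \<nu> u q) (pd X v q) / snd (X q)"
  unfolding second_form_covX[OF q] covX_def half_space_christoffel_def first_form_eq
  using height_pos[OF q]
  by (simp add: flat_form_simps flat_form_vertical[OF eps2(1)] normal'[OF q] X_deriv2_normal[OF q]
      field_simps power2_eq_square del: scaleR_Pair)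

lemma second_form_sym: "q \<in> U \<Longrightarrow> second_form \<epsilon> X \<nu> q u v = second_form \<epsilon> X \<nu> q v u"
  by (simp add: second_form_covX covX_sym[of q u])

text \<open>Read off from \<open>second_form_eq\<close>: pairing the derivative of \<nu> with a
  tangent vector is pairing its tangential part, and the first form carries the factor 1/s^2, s
  being the height.\<close>

definition shape :: "real^'n \<Rightarrow> real^'n \<Rightarrow> real^'n" where
  "shape q u = \<epsilon> *\<^sub>R (snd (\<nu> q) *\<^sub>R u - snd (X q) *\<^sub>R tang q (pd \<nu> u q))"

lemma first_form_shape:
  assumes q: "q \<in> U"
  shows "first_form \<epsilon> X q (shape q u) v = second_form \<epsilon> X \<nu> q u v"
proof -
  have "first_form \<epsilon> X q (shape q u) v = \<epsilon> * (snd (\<nu> q) * first_form \<epsilon> X q u v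
      - snd (X q) * first_form \<epsilon> X q (tang q (pd \<nu> u q)) v)"
    by (simp add: shape_def bilinear_lmul[OF bilinear_first_form[OF q]]
        bilinear_lsub[OF bilinear_first_form[OF q]])
  also have "first_form \<epsilon> X q (tang q (pd \<nu> u q)) v = F (pd \<nu> u q) (pd X v q) / (snd (X q))\<^sup>2"
    by (simp add: first_form_eq F_tang[OF q])
  finally show ?thesis
    using height_pos[OF q] by (simp add: second_form_eq[OF q] field_simps power2_eq_square)
qed

text \<open>The derivative of \<nu> has no normal component, so it is the image of its coordinate
  vector; the two factors s cancel the 1/s^2 in the first form.\<close>

lemma fourth_form_eq:
  assumes q: "q \<in> U"
  shows "fourth_form \<epsilon> \<nu> q u v = first_form \<epsilon> X q
    (snd (\<nu> q) *\<^sub>R u - \<epsilon> *\<^sub>R shape q u) (snd (\<nu> q) *\<^sub>R v - \<epsilon> *\<^sub>R shape q v)"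
proof -
  have 1: "snd (\<nu> q) *\<^sub>R u - \<epsilon> *\<^sub>R shape q u = snd (X q) *\<^sub>R tang q (pd \<nu> u q)" for u
    by (simp add: shape_def scaleR_diff_right eps2)
  have 2: "pd \<nu> u q = pd X (tang q (pd \<nu> u q)) q" for u
    using tang[OF q, of "pd \<nu> u q"] by (simp add: \<nu>_tangent[OF q])
  show ?thesis
    using height_pos[OF q]
    by (simp add: 1 fourth_form_def linear_cmul[OF linear_X[OF q]] flat_form_simps bilinear_lmul[OF bilinear_first_form[OF q]]
        bilinear_rmul[OF bilinear_first_form[OF q]] first_form_eq power2_eq_square flip: 2)
qed

lemma self_adjoint_shape:
  assumes q: "q \<in> U"
  shows "self_adjoint (first_form \<epsilon> X q) (shape q)"
proof (rule self_adjoint.intro)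
  show "linear (shape q)"
    unfolding shape_def linear_iff
    by (auto simp: linear_add[OF linear_\<nu>[OF q]] linear_cmul[OF linear_\<nu>[OF q]]
        linear_add[OF linear_tang[OF q]] linear_cmul[OF linear_tang[OF q]] algebra_simps)
  show "first_form \<epsilon> X q (shape q a) b = first_form \<epsilon> X q a (shape q b)" for a b
    by (simp add: first_form_shape[OF q] second_form_sym[OF q, of a] first_form_sym[of q a])
qed (use bilinear_first_form[OF q] first_form_sym first_form_pos[OF q] in blast)+

lemma principal_direction_space_eq:
  assumes q: "q \<in> U"
  shows "principal_direction_space \<epsilon> X \<nu> q \<kappa> = {u. shape q u = \<kappa> *\<^sub>R u}"
proof -
  interpret self_adjoint "first_form \<epsilon> X q" "shape q" by (rule self_adjoint_shape[OF q])
  have "(\<forall>v. second_form \<epsilon> X \<nu> q u v = \<kappa> * first_form \<epsilon> X q u v) \<longleftrightarrow> shape q u = \<kappa> *\<^sub>R u" for u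
    using nondeg[of "shape q u - \<kappa> *\<^sub>R u"]
    by (auto simp: g_simps simp flip: first_form_shape[OF q])
  then show ?thesis by (simp add: principal_direction_space_def)
qed

lemma principal_curvatures_eq:
  "q \<in> U \<Longrightarrow> principal_curvatures \<epsilon> X \<nu> q = {\<kappa>. \<exists>u. u \<noteq> 0 \<and> shape q u = \<kappa> *\<^sub>R u}"
  by (auto simp: principal_curvatures_def principal_direction_space_eq)

lemma umbilic_iff: "q \<in> U \<Longrightarrow> umbilic \<epsilon> X \<nu> q \<longleftrightarrow> (\<exists>\<kappa>. \<forall>u. shape q u = \<kappa> *\<^sub>R u)"
  using principal_direction_space_eq[of q] unfolding umbilic_def principal_direction_space_def
  by blast

section \<open>Differentiating the Gauss formula; the Gauss equation\<close>

lemma tangent_field_has_derivative: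
  assumes q: "q \<in> U" and G: "(G has_derivative G') (at q)"
  shows "((\<lambda>p. pd X (G p) p) has_derivative (\<lambda>u. pd X (G' u) q + pd (pd X (G q)) u q)) (at q)"
proof (rule has_derivative_transform_within_open[OF _ open_U q])
  \<comment> \<open>Both the point and the direction in \<open>pd X (G p) p\<close> vary. Expanding
    the direction in the standard basis leaves finitely many products of a scalar with a
    \<open>pd X\<close> in a fixed direction.\<close>
  have "((\<lambda>p. \<Sum>i\<in>UNIV. G p $ i *\<^sub>R pd X (axis i 1) p) has_derivative
      (\<lambda>u. \<Sum>i\<in>UNIV. G q $ i *\<^sub>R pd (pd X (axis i 1)) u q + G' u $ i *\<^sub>R pd X (axis i 1) q)) (at q)"
    by (intro has_derivative_sum has_derivative_scaleR X_deriv2 q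
        bounded_linear.has_derivative[OF bounded_linear_vec_nth] G)
  also have "(\<lambda>u. \<Sum>i\<in>UNIV. G q $ i *\<^sub>R pd (pd X (axis i 1)) u q + G' u $ i *\<^sub>R pd X (axis i 1) q)
      = (\<lambda>u. pd X (G' u) q + pd (pd X (G q)) u q)"
  proof
    fix u
    show "(\<Sum>i\<in>UNIV. G q $ i *\<^sub>R pd (pd X (axis i 1)) u q + G' u $ i *\<^sub>R pd X (axis i 1) q)
        = pd X (G' u) q + pd (pd X (G q)) u q"
      unfolding linear_axis_expansion[OF linear_X[OF q], of "G' u"]
        linear_axis_expansion[OF linear_X2'[OF q], of "G q" u]
      by (simp only: sum.distrib add.commute)
  qed
  finally show "((\<lambda>p. \<Sum>i\<in>UNIV. G p $ i *\<^sub>R pd X (axis i 1) p) has_derivative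
      (\<lambda>u. pd X (G' u) q + pd (pd X (G q)) u q)) (at q)" .
  show "(\<Sum>i\<in>UNIV. G p $ i *\<^sub>R pd X (axis i 1) p) = pd X (G p) p" if "p \<in> U" for p
    by (rule linear_axis_expansion[OF linear_X[OF that], symmetric])
qed

definition covX_deriv :: "real^'n \<Rightarrow> real^'n \<Rightarrow> real^'n \<Rightarrow> real^'n \<Rightarrow> 'n ambient" where
  "covX_deriv q v w u = pd (pd (pd X w) v) u q
    + inverse (snd (X q)) *\<^sub>R
      ((F (pd X v q) (pd (pd X w) u q) + F (pd (pd X v) u q) (pd X w q)) *\<^sub>R (0, \<epsilon>)
        - (snd (pd X v q) *\<^sub>R pd (pd X w) u q + snd (pd (pd X v) u q) *\<^sub>R pd X w q)
        - (snd (pd X w q) *\<^sub>R pd (pd X v) u q + snd (pd (pd X w) u q) *\<^sub>R pd X v q))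
    - (inverse (snd (X q)) * snd (pd X u q) * inverse (snd (X q))) *\<^sub>R
      (F (pd X v q) (pd X w q) *\<^sub>R (0, \<epsilon>) - snd (pd X v q) *\<^sub>R pd X w q - snd (pd X w q) *\<^sub>R pd X v q)"

lemma covX_has_derivative:
  assumes q: "q \<in> U"
  shows "((\<lambda>p. covX p v w) has_derivative covX_deriv q v w) (at q)"
  unfolding covX_def half_space_christoffel_def
proof (rule has_derivative_eq_rhs)
  have nz: "snd (X q) \<noteq> 0" using height_pos[OF q] by simp
  show "((\<lambda>p. pd (pd X w) v p + inverse (snd (X p)) *\<^sub>R
      (F (pd X v p) (pd X w p) *\<^sub>R (0, \<epsilon>) - snd (pd X v p) *\<^sub>R pd X w p - snd (pd X w p) *\<^sub>R pd X v p))
    has_derivative (\<lambda>u. pd (pd (pd X w) v) u q +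
      (inverse (snd (X q)) *\<^sub>R
      ((F (pd X v q) (pd X w q) *\<^sub>R 0 + (F (pd X v q) (pd (pd X w) u q) + F (pd (pd X v) u q) (pd X w q)) *\<^sub>R (0, \<epsilon>))
        - (snd (pd X v q) *\<^sub>R pd (pd X w) u q + snd (pd (pd X v) u q) *\<^sub>R pd X w q)
        - (snd (pd X w q) *\<^sub>R pd (pd X v) u q + snd (pd (pd X w) u q) *\<^sub>R pd X v q))
    + (- (inverse (snd (X q)) * snd (pd X u q) * inverse (snd (X q)))) *\<^sub>R
      (F (pd X v q) (pd X w q) *\<^sub>R (0, \<epsilon>) - snd (pd X v q) *\<^sub>R pd X w q - snd (pd X w q) *\<^sub>R pd X v q)))) (at q)"
    by (intro has_derivative_add has_derivative_diff has_derivative_scaleR has_derivative_snd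
        has_derivative_const bounded_bilinear.FDERIV[OF bounded_bilinear_flat_form]
        Deriv.has_derivative_inverse nz X_deriv X_deriv2 X_deriv3 q)
qed (simp add: covX_deriv_def fun_eq_iff)

text \<open>\<open>curvature\<close> differentiates \<Gamma> by \<open>frechet_derivative\<close>,
  which is meaningful only once some derivative exists. Bare existence suffices here.\<close>

lemma \<Gamma>_has_derivative:
  assumes q: "q \<in> U"
  shows "((\<lambda>p. \<Gamma> p v w) has_derivative (\<lambda>u. pd (\<lambda>p. \<Gamma> p v w) u q)) (at q)"
proof -
  have "(\<lambda>p. covX p v w) differentiable (at q)"
    using covX_has_derivative[OF q] differentiableI by blast
  then have "(\<lambda>p. \<Gamma> p v w) differentiable (at q)"
    unfolding \<Gamma>_def by (rule differentiable_tang[OF q])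
  then show ?thesis by (simp add: frechet_derivative_works)
qed

text \<open>Differentiating the Gauss formula and discarding the normal component of the result.\<close>

lemma first_form_cov_deriv_\<Gamma>:
  assumes q: "q \<in> U"
  shows "(snd (X q))\<^sup>2 * first_form \<epsilon> X q (pd (\<lambda>p. \<Gamma> p v w) u q + \<Gamma> q u (\<Gamma> q v w)) z
    = F (covX_deriv q v w u) (pd X z q)
      + F (half_space_christoffel \<epsilon> (X q) (pd X u q) (covX q v w)) (pd X z q)
      + \<epsilon> * (snd (X q))\<^sup>2 * second_form \<epsilon> X \<nu> q v w * second_form \<epsilon> X \<nu> q u z"
proof -
  define s where "s = snd (X q)"
  have s: "s > 0" using height_pos[OF q] by (simp add: s_def)
  define G where "G = \<Gamma> q v w"
  define G' where "G' = pd (\<lambda>p. \<Gamma> p v w) u q"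
  define c where "c p = \<epsilon> * F (covX p v w) (\<nu> p)" for p
  define Z where "Z = pd X z q"
  have Fc: "((\<lambda>p. F (covX p v w) (\<nu> p)) has_derivative
      (\<lambda>u. F (covX q v w) (pd \<nu> u q) + F (covX_deriv q v w u) (\<nu> q))) (at q)"
    by (intro bounded_bilinear.FDERIV[OF bounded_bilinear_flat_form] covX_has_derivative \<nu>_deriv q)
  \<comment> \<open>The derivative of the normal coefficient multiplies \<nu> only, so it disappears
    on pairing with the tangent vector \<open>Z\<close> and may stay unnamed.\<close>
  obtain c' where c': "(c has_derivative c') (at q)"
    unfolding c_def using has_derivative_mult_right[OF Fc] by blast
  have decomp: "covX p v w = pd X (\<Gamma> p v w) p + c p *\<^sub>R \<nu> p" if "p \<in> U" for p
    unfolding \<Gamma>_def c_def by (rule tang[OF that])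
  have "((\<lambda>p. pd X (\<Gamma> p v w) p + c p *\<^sub>R \<nu> p) has_derivative
     (\<lambda>u. (pd X (pd (\<lambda>p. \<Gamma> p v w) u q) q + pd (pd X (\<Gamma> q v w)) u q) + (c q *\<^sub>R pd \<nu> u q + c' u *\<^sub>R \<nu> q))) (at q)"
    by (intro has_derivative_add has_derivative_scaleR c' \<nu>_deriv q
        tangent_field_has_derivative[OF q \<Gamma>_has_derivative[OF q]])
  from has_derivative_transform_within_open[OF this open_U q decomp[symmetric]]
  have "covX_deriv q v w = (\<lambda>u. (pd X (pd (\<lambda>p. \<Gamma> p v w) u q) q + pd (pd X (\<Gamma> q v w)) u q)
      + (c q *\<^sub>R pd \<nu> u q + c' u *\<^sub>R \<nu> q))"
    by (rule has_derivative_unique[OF covX_has_derivative[OF q]])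
  then have D: "covX_deriv q v w u = pd X G' q + pd (pd X G) u q + (c q *\<^sub>R pd \<nu> u q + c' u *\<^sub>R \<nu> q)"
    by (simp add: G_def G'_def)
  have XG: "pd X G q = covX q v w - c q *\<^sub>R \<nu> q"
    using decomp[OF q] by (simp add: G_def)
  have "s\<^sup>2 * first_form \<epsilon> X q (G' + \<Gamma> q u G) z = F (pd X G' q) Z + F (covX q u G) Z"
    using s by (simp add: bilinear_ladd[OF bilinear_first_form[OF q]] first_form_\<Gamma>[OF q] first_form_eq[of q G']
        Z_def s_def distrib_left)
  also have "F (covX q u G) Z = F (pd (pd X G) u q) Z
      + F (half_space_christoffel \<epsilon> (X q) (pd X u q) (covX q v w)) Z
      - c q * F (half_space_christoffel \<epsilon> (X q) (pd X u q) (\<nu> q)) Z"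
    by (simp add: covX_def[of q u G] XG bilinear_rsub[OF bilinear_half_space_christoffel]
        bilinear_rmul[OF bilinear_half_space_christoffel] flat_form_simps)
  also have "F (half_space_christoffel \<epsilon> (X q) (pd X u q) (\<nu> q)) Z = - snd (\<nu> q) * F (pd X u q) Z / s"
    by (simp add: half_space_christoffel_def flat_form_simps normal'[OF q] normal[OF q] Z_def s_def field_simps
        del: scaleR_Pair)
  \<comment> \<open>The second derivative of \<open>X\<close> in direction \<open>G\<close> occurs
    here with the sign opposite to that in the expansion of \<open>covX q u G\<close>, and
    cancels.\<close>
  also have "F (pd X G' q) Z = F (covX_deriv q v w u) Z - F (pd (pd X G) u q) Z - c q * F (pd \<nu> u q) Z"
    by (simp add: D flat_form_simps Z_def normal[OF q])
  finally have "s\<^sup>2 * first_form \<epsilon> X q (G' + \<Gamma> q u G) z = F (covX_deriv q v w u) Z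
      + F (half_space_christoffel \<epsilon> (X q) (pd X u q) (covX q v w)) Z
      + c q * (snd (\<nu> q) * F (pd X u q) Z / s - F (pd \<nu> u q) Z)"
    by (simp add: algebra_simps)
  also have "snd (\<nu> q) * F (pd X u q) Z / s - F (pd \<nu> u q) Z = \<epsilon> * s * second_form \<epsilon> X \<nu> q u z"
    using s by (simp add: second_form_eq[OF q] first_form_eq eps2 right_diff_distrib Z_def s_def power2_eq_square)
  also have "c q = s * second_form \<epsilon> X \<nu> q v w"
    using s by (simp add: second_form_covX[OF q] c_def s_def)
  finally show ?thesis
    by (simp add: G_def G'_def Z_def s_def power2_eq_square mult_ac)
qed

text \<open>\<open>H u v\<close> pairs the iterated ambient derivative of the coordinate field
  \<open>w\<close>, along \<open>v\<close> and then \<open>u\<close>, with the tangent vector of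
  \<open>z\<close>. The identity says that the ambient space has constant curvature -\<epsilon>,
  tested on tangent vectors.\<close>

lemma ambient_curvature:
  fixes u v w z
  assumes q: "q \<in> U"
  defines "H \<equiv> \<lambda>u v. F (covX_deriv q v w u) (pd X z q)
      + F (half_space_christoffel \<epsilon> (X q) (pd X u q) (covX q v w)) (pd X z q)"
  shows "H u v - H v u = - \<epsilon> / (snd (X q))\<^sup>2 *
    (F (pd X v q) (pd X w q) * F (pd X u q) (pd X z q) - F (pd X u q) (pd X w q) * F (pd X v q) (pd X z q))"
proof -
  define r where "r = inverse (snd (X q))"
  have H: "H u v = F (pd (pd (pd X w) v) u q) (pd X z q)
    + r * ((F (pd X v q) (pd (pd X w) u q) + F (pd (pd X v) u q) (pd X w q)) * snd (pd X z q)
        - (snd (pd X v q) * F (pd (pd X w) u q) (pd X z q) + snd (pd (pd X v) u q) * F (pd X w q) (pd X z q))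
        - (snd (pd X w q) * F (pd (pd X v) u q) (pd X z q) + snd (pd (pd X w) u q) * F (pd X v q) (pd X z q)))
    - r * snd (pd X u q) * r *
      (F (pd X v q) (pd X w q) * snd (pd X z q) - snd (pd X v q) * F (pd X w q) (pd X z q) - snd (pd X w q) * F (pd X v q) (pd X z q))
    + r * (F (pd X u q) (pd (pd X w) v q) * snd (pd X z q) - snd (pd X u q) * F (pd (pd X w) v q) (pd X z q)
        - snd (pd (pd X w) v q) * F (pd X u q) (pd X z q))
    + r * r * ((F (pd X v q) (pd X w q) * snd (pd X u q) - snd (pd X v q) * F (pd X u q) (pd X w q) - snd (pd X w q) * F (pd X u q) (pd X v q)) * snd (pd X z q)
        - snd (pd X u q) * (F (pd X v q) (pd X w q) * snd (pd X z q) - snd (pd X v q) * F (pd X w q) (pd X z q) - snd (pd X w q) * F (pd X v q) (pd X z q))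
        - (F (pd X v q) (pd X w q) * \<epsilon> - 2 * snd (pd X v q) * snd (pd X w q)) * F (pd X u q) (pd X z q))" for u v
    unfolding H_def covX_deriv_def covX_def half_space_christoffel_def r_def[symmetric]
    by (simp add: flat_form_simps flat_form_vertical[OF eps2(1)] algebra_simps del: scaleR_Pair)
  have r2: "- \<epsilon> / (snd (X q))\<^sup>2 = - \<epsilon> * (r * r)"
    by (simp add: r_def power2_eq_square field_simps)
  \<comment> \<open>Once second and third derivatives are brought into a fixed order, everything
    containing them cancels, and a polynomial identity in flat products, heights and
    \<open>r\<close> remains.\<close>
  show ?thesis
    unfolding H r2 X_deriv3_sym[OF q, of w v u] X_deriv2_sym[OF q, of v u]
      flat_form_sym[of \<epsilon> "pd X v q" "pd X u q"] 
    by (simp add: algebra_simps)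
qed

lemma curvature_eq:
  assumes q: "q \<in> U"
  shows "curvature (first_form \<epsilon> X) q u v w =
    (pd (\<lambda>p. \<Gamma> p v w) u q + \<Gamma> q u (\<Gamma> q v w)) - (pd (\<lambda>p. \<Gamma> p u w) v q + \<Gamma> q v (\<Gamma> q u w))"
proof -
  have 1: "cov_deriv (first_form \<epsilon> X) id (\<lambda>_. w) p v = \<Gamma> p v w" if "p \<in> U" for p v
    by (simp add: cov_deriv_first_form[OF that])
  have "frechet_derivative (\<lambda>p. cov_deriv (first_form \<epsilon> X) id (\<lambda>_. w) p v) (at q)
      = frechet_derivative (\<lambda>p. \<Gamma> p v w) (at q)" for v
    by (rule frechet_derivative_cong_open[OF open_U q 1])
  then show ?thesis
    by (simp add: curvature_def cov_deriv_first_form[OF q, of "\<lambda>p. cov_deriv _ _ _ p _"] 1[OF q])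
qed

text \<open>Antisymmetrising the differentiated Gauss formula in \<open>u\<close> and
  \<open>v\<close> separates the ambient curvature from the second-form terms; the \<epsilon> before
  the latter is the squared length of the unit normal.\<close>

theorem gauss_equation:
  assumes q: "q \<in> U"
  shows "first_form \<epsilon> X q (curvature (first_form \<epsilon> X) q u v w) z =
    - \<epsilon> * (first_form \<epsilon> X q v w * first_form \<epsilon> X q u z - first_form \<epsilon> X q u w * first_form \<epsilon> X q v z)
    + \<epsilon> * (second_form \<epsilon> X \<nu> q v w * second_form \<epsilon> X \<nu> q u z
        - second_form \<epsilon> X \<nu> q u w * second_form \<epsilon> X \<nu> q v z)"
proof -
  define s where "s = snd (X q)"
  have s: "s > 0" using height_pos[OF q] by (simp add: s_def)
  note half = first_form_cov_deriv_\<Gamma>[OF q, folded s_def]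
  note amb = ambient_curvature[OF q, where u = u and v = v and w = w and z = z, folded s_def]
  have "s\<^sup>2 * first_form \<epsilon> X q (curvature (first_form \<epsilon> X) q u v w) z =
    - \<epsilon> / s\<^sup>2 * (F (pd X v q) (pd X w q) * F (pd X u q) (pd X z q) - F (pd X u q) (pd X w q) * F (pd X v q) (pd X z q))
    + s\<^sup>2 * (\<epsilon> * (second_form \<epsilon> X \<nu> q v w * second_form \<epsilon> X \<nu> q u z
        - second_form \<epsilon> X \<nu> q u w * second_form \<epsilon> X \<nu> q v z))"
    unfolding curvature_eq[OF q] bilinear_lsub[OF bilinear_first_form[OF q]] right_diff_distrib[of "s\<^sup>2"] half
    using amb by (simp add: algebra_simps)
  also have "\<dots> = s\<^sup>2 * (- \<epsilon> * (first_form \<epsilon> X q v w * first_form \<epsilon> X q u z - first_form \<epsilon> X q u w * first_form \<epsilon> X q v z)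
    + \<epsilon> * (second_form \<epsilon> X \<nu> q v w * second_form \<epsilon> X \<nu> q u z
        - second_form \<epsilon> X \<nu> q u w * second_form \<epsilon> X \<nu> q v z))"
    using s by (simp add: first_form_eq field_simps flip: s_def)
  finally show ?thesis using s by simp
qed

text \<open>Principal vectors for different curvatures are orthogonal for both forms, so all mixed
  terms vanish and the remaining ones share the factor I(u, u) I(v, v).\<close>

lemma sectional_curvature_principal:
  assumes q: "q \<in> U" and "u \<noteq> 0" "v \<noteq> 0" "shape q u = \<kappa> *\<^sub>R u" "shape q v = \<mu> *\<^sub>R v" "\<kappa> \<noteq> \<mu>"
  shows "sectional_curvature (first_form \<epsilon> X) q u v = - \<epsilon> + \<epsilon> * (\<kappa> * \<mu>)"
proof -
  interpret self_adjoint "first_form \<epsilon> X q" "shape q" by (rule self_adjoint_shape[OF q])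
  have uv: "first_form \<epsilon> X q u v = 0" "first_form \<epsilon> X q v u = 0"
    using orthogonal_eigenvectors assms sym by metis+
  have II: "second_form \<epsilon> X \<nu> q u a = \<kappa> * first_form \<epsilon> X q u a"
    "second_form \<epsilon> X \<nu> q v a = \<mu> * first_form \<epsilon> X q v a" for a
    using assms(4,5) by (simp_all add: g_simps flip: first_form_shape[OF q])
  have "first_form \<epsilon> X q u u > 0" "first_form \<epsilon> X q v v > 0" using pos assms by auto
  then show ?thesis
    unfolding sectional_curvature_def gauss_equation[OF q] II uv
    by (simp add: field_simps)
qed

text \<open>Every principal curvature has a nonzero principal vector, so the curvature condition on
  all pairs of vectors is never vacuous and recovers the equation for the product of the
  curvatures.\<close>

theorem proportional_iff_curvature:
  assumes q: "q \<in> U" and "\<not> umbilic \<epsilon> X \<nu> q"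
  shows "(\<exists>\<rho>. \<forall>u v. fourth_form \<epsilon> \<nu> q u v = \<rho> * second_form \<epsilon> X \<nu> q u v) \<longleftrightarrow>
    card (principal_curvatures \<epsilon> X \<nu> q) = 2 \<and>
      (\<forall>\<kappa>\<in>principal_curvatures \<epsilon> X \<nu> q. \<forall>\<mu>\<in>principal_curvatures \<epsilon> X \<nu> q. \<kappa> \<noteq> \<mu> \<longrightarrow>
         (\<forall>u\<in>principal_direction_space \<epsilon> X \<nu> q \<kappa>.
          \<forall>v\<in>principal_direction_space \<epsilon> X \<nu> q \<mu>. u \<noteq> 0 \<longrightarrow> v \<noteq> 0 \<longrightarrow>
            sectional_curvature (first_form \<epsilon> X) q u v = - \<epsilon> + \<epsilon> * (snd (\<nu> q))\<^sup>2))"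
proof -
  interpret self_adjoint "first_form \<epsilon> X q" "shape q" by (rule self_adjoint_shape[OF q])
  have nonscalar: "\<exists>a. shape q a \<noteq> \<kappa> *\<^sub>R a" for \<kappa>
    using assms(2) umbilic_iff[OF q] by blast
  have ev: "principal_curvatures \<epsilon> X \<nu> q = eigenvalues"
    by (simp add: principal_curvatures_eq[OF q] eigenvalues_def)
  have "(\<forall>u\<in>principal_direction_space \<epsilon> X \<nu> q \<kappa>.
      \<forall>v\<in>principal_direction_space \<epsilon> X \<nu> q \<mu>. u \<noteq> 0 \<longrightarrow> v \<noteq> 0 \<longrightarrow>
        sectional_curvature (first_form \<epsilon> X) q u v = - \<epsilon> + \<epsilon> * (snd (\<nu> q))\<^sup>2) \<longleftrightarrow> \<kappa> * \<mu> = (snd (\<nu> q))\<^sup>2"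
    if km: "\<kappa> \<in> eigenvalues" "\<mu> \<in> eigenvalues" "\<kappa> \<noteq> \<mu>" for \<kappa> \<mu>
  proof -
    have "sectional_curvature (first_form \<epsilon> X) q u v = - \<epsilon> + \<epsilon> * (snd (\<nu> q))\<^sup>2 \<longleftrightarrow> \<kappa> * \<mu> = (snd (\<nu> q))\<^sup>2"
      if "u \<noteq> 0" "v \<noteq> 0" "shape q u = \<kappa> *\<^sub>R u" "shape q v = \<mu> *\<^sub>R v" for u v
      using sectional_curvature_principal[OF q that km(3)] eps2(4) by simp
    then show ?thesis
      using km unfolding principal_direction_space_eq[OF q] eigenvalues_def by blast
  qed
  then show ?thesis
    unfolding ev fourth_form_eq[OF q] first_form_shape[OF q, symmetric]
    unfolding square_proportional_iff[OF eps2(1) nonscalar, of "snd (\<nu> q)"]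
    by blast
qed

end

section \<open>Conformal factors and changes of charts\<close>

context hypersurface_patch
begin

text \<open>The least-squares solution \<open>\<rho>\<close> of \<open>IV = \<rho> II\<close>; unlike a quotient \<open>IV(u, v) / II(u, v)\<close> for
  fixed \<open>u\<close>, \<open>v\<close> it is defined at every non-umbilic point.\<close>

definition conformal_factor :: "real^'n \<Rightarrow> real" where
  "conformal_factor q =
     (\<Sum>i\<in>UNIV. \<Sum>j\<in>UNIV. fourth_form \<epsilon> \<nu> q (axis i 1) (axis j 1) * second_form \<epsilon> X \<nu> q (axis i 1) (axis j 1))
     * inverse (\<Sum>i\<in>UNIV. \<Sum>j\<in>UNIV. second_form \<epsilon> X \<nu> q (axis i 1) (axis j 1) * second_form \<epsilon> X \<nu> q (axis i 1) (axis j 1))"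

lemma linear_second_form:
  assumes q: "q \<in> U"
  shows "linear (\<lambda>u. second_form \<epsilon> X \<nu> q u v)" "linear (\<lambda>v. second_form \<epsilon> X \<nu> q u v)"
proof -
  interpret self_adjoint "first_form \<epsilon> X q" "shape q" by (rule self_adjoint_shape[OF q])
  show "linear (\<lambda>u. second_form \<epsilon> X \<nu> q u v)" "linear (\<lambda>v. second_form \<epsilon> X \<nu> q u v)"
    by (auto simp: linear_iff S_simps g_simps simp flip: first_form_shape[OF q])
qed

text \<open>A vanishing II is the zero multiple of I, hence umbilic.\<close>

lemma second_form_sum_squares_nonzero:
  assumes q: "q \<in> U" and "\<not> umbilic \<epsilon> X \<nu> q"
  shows "(\<Sum>i\<in>UNIV. \<Sum>j\<in>UNIV. second_form \<epsilon> X \<nu> q (axis i 1) (axis j 1) * second_form \<epsilon> X \<nu> q (axis i 1) (axis j 1)) \<noteq> 0"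
proof
  assume "(\<Sum>i\<in>UNIV. \<Sum>j\<in>UNIV. second_form \<epsilon> X \<nu> q (axis i 1) (axis j 1) * second_form \<epsilon> X \<nu> q (axis i 1) (axis j 1)) = 0"
  then have "second_form \<epsilon> X \<nu> q (axis i 1) (axis j 1) = 0" for i j
    by (simp add: sum_nonneg_eq_0_iff sum_nonneg)
  then have "second_form \<epsilon> X \<nu> q u (axis j 1) = 0" for u j
    by (subst linear_axis_expansion[OF linear_second_form(1)[OF q]]) simp
  then have "second_form \<epsilon> X \<nu> q u v = 0" for u v
    by (subst linear_axis_expansion[OF linear_second_form(2)[OF q]]) simp
  then show False using assms(2) by (auto simp: umbilic_def)
qed

lemma conformal_factor_unique:
  assumes "q \<in> U" "\<not> umbilic \<epsilon> X \<nu> q"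
    and "\<And>u v. fourth_form \<epsilon> \<nu> q u v = \<rho> * second_form \<epsilon> X \<nu> q u v"
  shows "conformal_factor q = \<rho>"
  using second_form_sum_squares_nonzero[OF assms(1,2)]
  by (simp add: conformal_factor_def assms(3) mult.assoc flip: sum_distrib_left)

text \<open>II is a definite description; its smoothness is read off the closed formula in the first
  derivatives of \<open>X\<close> and \<nu>.\<close>

lemma smooth_second_form: "smooth_on U (\<lambda>q. second_form \<epsilon> X \<nu> q u v)"
proof (rule smooth_on_cong[OF open_U])
  note F = smooth_on_bounded_bilinear[OF bounded_bilinear_flat_form open_U]
  have s: "smooth_on U (\<lambda>q. inverse (snd (X q)))"
    using height_pos by (intro smooth_on_inverse open_U smooth_on_bounded_linear[OF bounded_linear_snd] smooth_X) force
  show "smooth_on U (\<lambda>q. \<epsilon> * snd (\<nu> q) * (F (pd X u q) (pd X v q) * (inverse (snd (X q)) * inverse (snd (X q))))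
      + - \<epsilon> * (F (pd \<nu> u q) (pd X v q) * inverse (snd (X q))))"
    by (intro smooth_on_add smooth_on_mult F s smooth_on_const open_U smooth_on_pd smooth_X smooth_\<nu>
        smooth_on_bounded_linear[OF bounded_linear_snd])
qed (simp add: second_form_eq first_form_eq power2_eq_square divide_inverse mult.assoc)

lemma smooth_conformal_factor:
  assumes "\<And>q. q \<in> U \<Longrightarrow> \<not> umbilic \<epsilon> X \<nu> q"
  shows "smooth_on U conformal_factor"
proof -
  have IV: "smooth_on U (\<lambda>q. fourth_form \<epsilon> \<nu> q u v)" for u v
    unfolding fourth_form_def
    by (intro smooth_on_bounded_bilinear[OF bounded_bilinear_flat_form] open_U smooth_on_pd smooth_\<nu>)
  show ?thesis
    unfolding conformal_factor_def
    using second_form_sum_squares_nonzero[OF _ assms]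
    by (intro smooth_on_mult smooth_on_inverse smooth_on_sum open_U IV smooth_second_form) auto
qed

end

section \<open>Changes of charts\<close>

lemma forms_coordinate_change:
  assumes P: "hypersurface_patch \<epsilon> U X \<nu>" and P': "hypersurface_patch \<epsilon> U' X' \<nu>'"
    and W: "open W" "q \<in> W" "W \<subseteq> U" "\<tau> ` W \<subseteq> U'" and \<tau>: "\<tau> differentiable (at q)"
    and eq: "\<And>p. p \<in> W \<Longrightarrow> X p = X' (\<tau> p)" "\<And>p. p \<in> W \<Longrightarrow> \<nu> p = \<nu>' (\<tau> p)"
  shows "fourth_form \<epsilon> \<nu> q u v = fourth_form \<epsilon> \<nu>' (\<tau> q) (pd \<tau> u q) (pd \<tau> v q)"
    and "second_form \<epsilon> X \<nu> q u v = second_form \<epsilon> X' \<nu>' (\<tau> q) (pd \<tau> u q) (pd \<tau> v q)"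
proof -
  interpret P: hypersurface_patch \<epsilon> U X \<nu> by (rule P)
  interpret P': hypersurface_patch \<epsilon> U' X' \<nu>' by (rule P')
  have q: "q \<in> U" "\<tau> q \<in> U'" using W by auto
  have chain: "pd f u q = pd g (pd \<tau> u q) (\<tau> q)"
    if "g differentiable (at (\<tau> q))" "\<And>p. p \<in> W \<Longrightarrow> f p = g (\<tau> p)" for f g :: "_ \<Rightarrow> 'a ambient" and u
  proof -
    have "frechet_derivative f (at q) = frechet_derivative (g \<circ> \<tau>) (at q)"
      by (rule frechet_derivative_cong_open[OF W(1,2)]) (simp add: that)
    then show ?thesis using frechet_derivative_compose[OF \<tau> that(1)] by simp
  qed
  have X: "pd X u q = pd X' (pd \<tau> u q) (\<tau> q)" for u
    using P'.X_deriv[OF q(2)] eq(1) by (intro chain differentiableI)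
  have \<nu>: "pd \<nu> u q = pd \<nu>' (pd \<tau> u q) (\<tau> q)" for u
    using P'.\<nu>_deriv[OF q(2)] eq(2) by (intro chain differentiableI)
  show "fourth_form \<epsilon> \<nu> q u v = fourth_form \<epsilon> \<nu>' (\<tau> q) (pd \<tau> u q) (pd \<tau> v q)"
    by (simp add: fourth_form_def \<nu>)
  \<comment> \<open>The closed formula for II contains first derivatives only, so the chain rule
    suffices and no second derivative of the transition map \<tau> appears.\<close>
  show "second_form \<epsilon> X \<nu> q u v = second_form \<epsilon> X' \<nu>' (\<tau> q) (pd \<tau> u q) (pd \<tau> v q)"
    by (simp add: P.second_form_eq[OF q(1)] P'.second_form_eq[OF q(2)]
        P.first_form_eq P'.first_form_eq X \<nu> eq W)
qed

context
  fixes A :: "('m::topological_space, 'n::finite) chart set"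
  assumes atlas: "smooth_atlas A"
begin

lemma chart_homeomorphism: "c \<in> A \<Longrightarrow> homeomorphism (fst c) (chart_range c) (snd c) (chart_inv c)"
  and chart_open: "c \<in> A \<Longrightarrow> open (fst c)" "c \<in> A \<Longrightarrow> open (chart_range c)"
  using atlas unfolding smooth_atlas_def by blast+

lemma chart_apply:
  "c \<in> A \<Longrightarrow> p \<in> fst c \<Longrightarrow> chart_inv c (snd c p) = p"
  "c \<in> A \<Longrightarrow> p \<in> fst c \<Longrightarrow> snd c p \<in> chart_range c"
  "c \<in> A \<Longrightarrow> q \<in> chart_range c \<Longrightarrow> snd c (chart_inv c q) = q"
  "c \<in> A \<Longrightarrow> q \<in> chart_range c \<Longrightarrow> chart_inv c q \<in> fst c"
  using chart_homeomorphism[of c] unfolding homeomorphism_def by auto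

lemma open_chart_overlap:
  assumes "c \<in> A" "d \<in> A"
  shows "open (snd c ` (fst c \<inter> fst d))"
proof -
  have "openin (top_of_set (fst c)) (fst c \<inter> fst d)"
    using chart_open(1)[OF assms(2)] by (simp add: openin_open_Int)
  then have "openin (top_of_set (chart_range c)) (snd c ` (fst c \<inter> fst d))"
    by (rule homeomorphism_imp_open_map[OF chart_homeomorphism[OF assms(1)]])
  then show ?thesis
    using chart_open(2)[OF assms(1)] openin_open_trans by blast
qed

text \<open>Both forms in the chart \<open>c\<close> are pullbacks of those in \<open>d\<close> by
  the same linear map, so the identity carries over with the same factor.\<close>

lemma proportionality_chart_independent:
  fixes x \<eta> :: "'m \<Rightarrow> 'n ambient"
  assumes patch: "\<And>c. c \<in> A \<Longrightarrow> hypersurface_patch \<epsilon> (chart_range c) (x \<circ> chart_inv c) (\<eta> \<circ> chart_inv c)"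
    and c: "c \<in> A" and d: "d \<in> A" and p: "p \<in> fst c" "p \<in> fst d"
    and proportional: "\<And>u v. fourth_form \<epsilon> (\<eta> \<circ> chart_inv d) (snd d p) u v
      = \<rho> * second_form \<epsilon> (x \<circ> chart_inv d) (\<eta> \<circ> chart_inv d) (snd d p) u v"
  shows "fourth_form \<epsilon> (\<eta> \<circ> chart_inv c) (snd c p) u v
      = \<rho> * second_form \<epsilon> (x \<circ> chart_inv c) (\<eta> \<circ> chart_inv c) (snd c p) u v"
proof -
  define W where "W = snd c ` (fst c \<inter> fst d)"
  define \<tau> where "\<tau> = snd d \<circ> chart_inv c"
  have W: "open W" "snd c p \<in> W" "W \<subseteq> chart_range c" "\<tau> ` W \<subseteq> chart_range d"
    using open_chart_overlap[OF c d] p chart_apply(1,2)[OF c] chart_apply(2)[OF d]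
    by (auto simp: W_def \<tau>_def)
  have "smooth_on W \<tau>"
    using atlas c d unfolding smooth_atlas_def W_def \<tau>_def by blast
  then have \<tau>: "\<tau> differentiable (at (snd c p))"
    using W(2) by (rule smooth_on_differentiable)
  have eq: "(f \<circ> chart_inv c) y = (f \<circ> chart_inv d) (\<tau> y)" if "y \<in> W" for f :: "'m \<Rightarrow> 'n ambient" and y
    using that chart_apply(1)[OF c] chart_apply(1)[OF d] by (auto simp: W_def \<tau>_def)
  have \<tau>p: "\<tau> (snd c p) = snd d p"
    using chart_apply(1)[OF c p(1)] by (simp add: \<tau>_def)
  show ?thesis
    using forms_coordinate_change[where X = "x \<circ> chart_inv c" and X' = "x \<circ> chart_inv d"
        and \<nu> = "\<eta> \<circ> chart_inv c" and \<nu>' = "\<eta> \<circ> chart_inv d",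
        OF patch[OF c] patch[OF d] W \<tau> eq eq] proportional
    unfolding \<tau>p by simp
qed

text \<open>The step from a factor at each point to one smooth function: uniqueness at non-umbilic
  points identifies any factor with the least-squares one, which is smooth in each chart.\<close>

lemma conformal_iff_proportional:
  fixes x \<eta> :: "'m \<Rightarrow> 'n ambient"
  assumes patch: "\<And>c. c \<in> A \<Longrightarrow> hypersurface_patch \<epsilon> (chart_range c) (x \<circ> chart_inv c) (\<eta> \<circ> chart_inv c)"
    and umb: "without_umbilics \<epsilon> A x \<eta>"
  shows "gauss_map_conformal \<epsilon> A x \<eta> \<longleftrightarrow>
    (\<forall>c\<in>A. \<forall>q\<in>chart_range c. \<exists>\<rho>. \<forall>u v. fourth_form \<epsilon> (\<eta> \<circ> chart_inv c) q u v
      = \<rho> * second_form \<epsilon> (x \<circ> chart_inv c) (\<eta> \<circ> chart_inv c) q u v)"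
    (is "_ \<longleftrightarrow> ?R")
proof
  show ?R if "gauss_map_conformal \<epsilon> A x \<eta>"
    using that unfolding gauss_map_conformal_def by blast
next
  assume R: ?R
  define factor where "factor c = hypersurface_patch.conformal_factor \<epsilon> (x \<circ> chart_inv c) (\<eta> \<circ> chart_inv c)" for c
  define ch where "ch p = (SOME c. c \<in> A \<and> p \<in> fst c)" for p
  define \<rho> where "\<rho> p = factor (ch p) (snd (ch p) p)" for p
  have ch: "ch p \<in> A" "p \<in> fst (ch p)" for p
  proof -
    have "\<exists>c. c \<in> A \<and> p \<in> fst c" using atlas unfolding smooth_atlas_def by blast
    from someI_ex[OF this] show "ch p \<in> A" "p \<in> fst (ch p)" unfolding ch_def by auto
  qed
  have nu: "\<not> umbilic \<epsilon> (x \<circ> chart_inv c) (\<eta> \<circ> chart_inv c) q" if "c \<in> A" "q \<in> chart_range c" for c q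
    using umb that unfolding without_umbilics_def by blast
  have factor: "factor c q = r"
    if "c \<in> A" "q \<in> chart_range c" "\<And>u v. fourth_form \<epsilon> (\<eta> \<circ> chart_inv c) q u v
      = r * second_form \<epsilon> (x \<circ> chart_inv c) (\<eta> \<circ> chart_inv c) q u v" for c q r
    unfolding factor_def
    by (rule hypersurface_patch.conformal_factor_unique[OF patch[OF that(1)] that(2) nu[OF that(1,2)] that(3)])
  have proportional: "fourth_form \<epsilon> (\<eta> \<circ> chart_inv c) q u v
      = factor c q * second_form \<epsilon> (x \<circ> chart_inv c) (\<eta> \<circ> chart_inv c) q u v"
    if "c \<in> A" "q \<in> chart_range c" for c q u v
    using R that factor by metis
  \<comment> \<open>Although \<rho> picks an arbitrary chart at every point, it agrees with the
    factor of any given chart throughout its range, and therefore inherits smoothness.\<close>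
  have indep: "\<rho> (chart_inv c q) = factor c q" if c: "c \<in> A" and q: "q \<in> chart_range c" for c q
  proof -
    let ?p = "chart_inv c q"
    have p: "?p \<in> fst c" "snd c ?p = q" using chart_apply(3,4)[OF c q] by auto
    show ?thesis
      unfolding \<rho>_def
    proof (rule factor[OF ch(1) chart_apply(2)[OF ch]])
      show "fourth_form \<epsilon> (\<eta> \<circ> chart_inv (ch ?p)) (snd (ch ?p) ?p) u v = factor c q *
        second_form \<epsilon> (x \<circ> chart_inv (ch ?p)) (\<eta> \<circ> chart_inv (ch ?p)) (snd (ch ?p) ?p) u v" for u v
        by (rule proportionality_chart_independent[OF patch ch(1) c ch(2) p(1)])
          (use proportional[OF c q] p(2) in simp_all)
    qed
  qed
  have "smooth_map A \<rho>"
    unfolding smooth_map_def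
  proof
    fix c assume c: "c \<in> A"
    have sm: "smooth_on (chart_range c) (factor c)"
      unfolding factor_def
      by (rule hypersurface_patch.smooth_conformal_factor[OF patch[OF c] nu[OF c]])
    show "smooth_on (chart_range c) (\<rho> \<circ> chart_inv c)"
      by (rule smooth_on_cong[OF chart_open(2)[OF c] _ sm]) (simp add: indep[OF c])
  qed
  then show "gauss_map_conformal \<epsilon> A x \<eta>"
    unfolding gauss_map_conformal_def using proportional indep by (intro exI[of _ \<rho>]) simp
qed

text \<open>Positivity on tangent vectors has two sources: for \<epsilon> = 1 the flat form is the
  Euclidean inner product and the immersion is injective on tangent vectors; for \<epsilon> = -1 it
  is the space-like condition, up to the positive square of the height.\<close>

lemma hypersurface_patch_chart:
  fixes x \<eta> :: "'m \<Rightarrow> 'n ambient"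
  assumes imm: "immersed_in_half_space A x" and gauss: "normal_gauss_map \<epsilon> A x \<eta>"
    and eps: "\<epsilon> = 1 \<or> \<epsilon> = - 1 \<and> space_like \<epsilon> A x" and c: "c \<in> A"
  shows "hypersurface_patch \<epsilon> (chart_range c) (x \<circ> chart_inv c) (\<eta> \<circ> chart_inv c)"
proof
  show "\<epsilon> = 1 \<or> \<epsilon> = - 1" using eps by blast
  show "open (chart_range c)" by (rule chart_open(2)[OF c])
  show sm: "smooth_on (chart_range c) (x \<circ> chart_inv c)" "smooth_on (chart_range c) (\<eta> \<circ> chart_inv c)"
    using imm gauss c unfolding immersed_in_half_space_def normal_gauss_map_def smooth_map_def by blast+
  show pos: "snd ((x \<circ> chart_inv c) q) > 0" for q
    using imm unfolding immersed_in_half_space_def by simp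
  show "flat_form \<epsilon> ((\<eta> \<circ> chart_inv c) q) ((\<eta> \<circ> chart_inv c) q) = \<epsilon>" for q
    using gauss unfolding normal_gauss_map_def by simp
  fix q u assume q: "q \<in> chart_range c"
  have "half_space_metric \<epsilon> (x (chart_inv c q)) (snd (x (chart_inv c q)) *\<^sub>R \<eta> (chart_inv c q))
      (pd (x \<circ> chart_inv c) u q) = 0"
    using gauss c q unfolding normal_gauss_map_def by blast
  then show "flat_form \<epsilon> ((\<eta> \<circ> chart_inv c) q) (pd (x \<circ> chart_inv c) u q) = 0"
    using pos[of q] by (simp add: half_space_metric_def flat_form_simps)
  assume u: "u \<noteq> 0"
  show "flat_form \<epsilon> (pd (x \<circ> chart_inv c) u q) (pd (x \<circ> chart_inv c) u q) > 0"
    using eps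
  proof
    assume e: "\<epsilon> = 1"
    have lin: "linear (frechet_derivative (x \<circ> chart_inv c) (at q))"
      using smooth_on_differentiable[OF sm(1) q] by (rule linear_frechet_derivative)
    have "inj (frechet_derivative (x \<circ> chart_inv c) (at q))"
      using imm c q unfolding immersed_in_half_space_def by blast
    then have "pd (x \<circ> chart_inv c) u q \<noteq> 0"
      using u linear_injective_0[OF lin] by blast
    moreover have "flat_form \<epsilon> a a = a \<bullet> a" for a :: "'n ambient"
      by (simp add: flat_form_def e inner_prod_def)
    ultimately show ?thesis by simp
  next
    assume "\<epsilon> = - 1 \<and> space_like \<epsilon> A x"
    then have "first_form \<epsilon> (x \<circ> chart_inv c) q u u > 0"
      using c q u unfolding space_like_def by blast
    then show ?thesis
      by (simp add: first_form_def half_space_metric_def zero_less_divide_iff)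
  qed
qed

lemma conformal_iff_curvature:
  fixes x \<eta> :: "'m \<Rightarrow> 'n ambient"
  assumes "immersed_in_half_space A x" "normal_gauss_map \<epsilon> A x \<eta>"
    and "\<epsilon> = 1 \<or> \<epsilon> = - 1 \<and> space_like \<epsilon> A x" and umb: "without_umbilics \<epsilon> A x \<eta>"
  shows "gauss_map_conformal \<epsilon> A x \<eta> \<longleftrightarrow>
         (\<forall>c\<in>A. \<forall>q\<in>chart_range c.
            let X = x \<circ> chart_inv c; \<nu> = \<eta> \<circ> chart_inv c in
            card (principal_curvatures \<epsilon> X \<nu> q) = 2 \<and>
            (\<forall>\<kappa>\<in>principal_curvatures \<epsilon> X \<nu> q. \<forall>\<mu>\<in>principal_curvatures \<epsilon> X \<nu> q. \<kappa> \<noteq> \<mu> \<longrightarrow>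
               (\<forall>u\<in>principal_direction_space \<epsilon> X \<nu> q \<kappa>.
                \<forall>v\<in>principal_direction_space \<epsilon> X \<nu> q \<mu>. u \<noteq> 0 \<longrightarrow> v \<noteq> 0 \<longrightarrow>
                  sectional_curvature (first_form \<epsilon> X) q u v = - \<epsilon> + \<epsilon> * (snd (\<nu> q))\<^sup>2)))"
proof -
  note patch = hypersurface_patch_chart[OF assms(1-3)]
  have nu: "\<not> umbilic \<epsilon> (x \<circ> chart_inv c) (\<eta> \<circ> chart_inv c) q" if "c \<in> A" "q \<in> chart_range c" for c q
    using umb that unfolding without_umbilics_def by blast
  have "gauss_map_conformal \<epsilon> A x \<eta> \<longleftrightarrow>
    (\<forall>c\<in>A. \<forall>q\<in>chart_range c. \<exists>\<rho>. \<forall>u v. fourth_form \<epsilon> (\<eta> \<circ> chart_inv c) q u v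
      = \<rho> * second_form \<epsilon> (x \<circ> chart_inv c) (\<eta> \<circ> chart_inv c) q u v)"
    by (rule conformal_iff_proportional[OF patch umb])
  then show ?thesis
    using hypersurface_patch.proportional_iff_curvature[OF patch _ nu]
    by (simp only: Let_def cong: ball_cong)
qed

end

theorem theorem3p2:
  fixes A :: "('m::{t2_space, second_countable_topology}, 'n::finite) chart set"
    and x \<eta> :: "'m \<Rightarrow> 'n ambient"
  assumes "smooth_atlas A"
    and "immersed_in_half_space A x"
  shows
    "(normal_gauss_map 1 A x \<eta> \<and> without_umbilics 1 A x \<eta> \<longrightarrow>
        (gauss_map_conformal 1 A x \<eta> \<longleftrightarrow>
         (\<forall>c\<in>A. \<forall>q\<in>chart_range c.
            let X = x \<circ> chart_inv c; \<nu> = \<eta> \<circ> chart_inv c in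
            card (principal_curvatures 1 X \<nu> q) = 2 \<and>
            (\<forall>\<kappa>\<in>principal_curvatures 1 X \<nu> q. \<forall>\<mu>\<in>principal_curvatures 1 X \<nu> q. \<kappa> \<noteq> \<mu> \<longrightarrow>
               (\<forall>u\<in>principal_direction_space 1 X \<nu> q \<kappa>.
                \<forall>v\<in>principal_direction_space 1 X \<nu> q \<mu>. u \<noteq> 0 \<longrightarrow> v \<noteq> 0 \<longrightarrow>
                  sectional_curvature (first_form 1 X) q u v = - 1 + (snd (\<nu> q))\<^sup>2)))))
     \<and>
     (space_like (- 1) A x \<and> normal_gauss_map (- 1) A x \<eta> \<and> without_umbilics (- 1) A x \<eta> \<longrightarrow>
        (gauss_map_conformal (- 1) A x \<eta> \<longleftrightarrow>
         (\<forall>c\<in>A. \<forall>q\<in>chart_range c.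
            let X = x \<circ> chart_inv c; \<nu> = \<eta> \<circ> chart_inv c in
            card (principal_curvatures (- 1) X \<nu> q) = 2 \<and>
            (\<forall>\<kappa>\<in>principal_curvatures (- 1) X \<nu> q. \<forall>\<mu>\<in>principal_curvatures (- 1) X \<nu> q. \<kappa> \<noteq> \<mu> \<longrightarrow>
               (\<forall>u\<in>principal_direction_space (- 1) X \<nu> q \<kappa>.
                \<forall>v\<in>principal_direction_space (- 1) X \<nu> q \<mu>. u \<noteq> 0 \<longrightarrow> v \<noteq> 0 \<longrightarrow>
                  sectional_curvature (first_form (- 1) X) q u v = 1 - (snd (\<nu> q))\<^sup>2)))))"
  using conformal_iff_curvature[OF assms, of 1 \<eta>] conformal_iff_curvature[OF assms, of "- 1" \<eta>]
  by simp

end
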